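(* There is an absolute constant $a>0$ such that for any constant $c>0$ there is a constant $C>0$ (depending only on $c$) for which the following holds for all sufficiently small $\gamma,\epsilon>0$ and all dimensions $d\ge C/\gamma$. Any Statistical Query algorithm that learns the class of $\gamma$-margin halfspaces on the unit sphere $\mathbb S^{d-1}$ in the presence of Random Classification Noise of rate $\eta=1/3$ to misclassification error $\eta+\epsilon$ either requires at least $2^{(1/\gamma)^{a c}}$ statistical queries, or makes at least one query with tolerance at most $C\,\epsilon\,\gamma^{1/4-c}$.
   Context: $\mathbb S^{d-1}$ is the unit sphere of $\mathbb R^d$; $\mathrm{sgn}(t)=1$ if $t\ge 0$ and $-1$ otherwise. A distribution $\mathcal D$ on $\mathbb S^{d-1}\times\{\pm1\}$ is a $\gamma$-margin halfspace with Random Classification Noise (RCN) of rate $\eta\in(0,1/2)$ if there is an (unknown) unit vector $\mathbf w^*$ such that (1) $\Pr_{(\mathbf x,y)\sim\mathcal D}[|\mathbf w^*\cdot\mathbf x|<\gamma]=0$; and (2) conditionally on each $\mathbf x$, $y=\mathrm{sgn}(\mathbf w^*\cdot\mathbf x)$ with probability $1-\eta$ and $y=-\mathrm{sgn}(\mathbf w^*\cdot\mathbf x)$ with probability $\eta$. Statistical Query (SQ) algorithms do not see samples; they access the input distribution $D$ through an oracle. A statistical query is a bounded function $f$ from the domain to $[-1,1]$. For tolerance $\tau>0$, the oracle $\mathrm{STAT}(\tau)$ answers $f$ with some value $v$ such that $|v-\mathbf E_{z\sim D}[f(z)]|\le\tau$ (an arbitrary, possibly adversarial, such value). An SQ algorithm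 learns the class to error $\eta+\epsilon$ if, for every distribution $\mathcal D$ in the class and all valid oracle answers, it outputs with high probability (say at least $9/10$) a hypothesis $h:\mathbb R^d\to\{\pm1\}$ with $\Pr_{(\mathbf x,y)\sim\mathcal D}[h(\mathbf x)\ne y]\le\eta+\epsilon$. The lower bound is worst-case over distributions in the class and valid oracle answers. *)

theory Defs
  imports "HOL-Probability.Probability"
begin

section \<open>Margin halfspaces with random classification noise\<close>

text \<open>
  The dimension is quantified inside the statement, so points of \<open>d\<close>-dimensional Euclidean space
  are functions on \<open>{..<d}\<close>, taken in the extensional carrier of the finite product measure.
\<close>

type_synonym point = "nat \<Rightarrow> real"

abbreviation euclid :: "nat \<Rightarrow> point measure" where
  "euclid d \<equiv> (\<Pi>\<^sub>M i\<in>{..<d}. (borel :: real measure))"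

definition unit_sphere :: "nat \<Rightarrow> point set" where
  "unit_sphere d = {x \<in> space (euclid d). L2_set x {..<d} = 1}"

definition dot :: "nat \<Rightarrow> point \<Rightarrow> point \<Rightarrow> real" where
  "dot d w x = (\<Sum>i<d. w i * x i)"

text \<open>Unlike the library's \<^const>\<open>sgn\<close>, this takes the value \<open>1\<close> at \<open>0\<close>.\<close>

definition sign :: "real \<Rightarrow> int" where
  "sign t = (if t \<ge> 0 then 1 else -1)"

definition sphere_space :: "nat \<Rightarrow> point measure" where
  "sphere_space d = restrict_space (euclid d) (unit_sphere d)"

definition example_space :: "nat \<Rightarrow> (point \<times> int) measure" where
  "example_space d = sphere_space d \<Otimes>\<^sub>M count_space {-1, 1}"

text \<open>
  The last two conjuncts say that, given \<open>x\<close>, the label is \<open>sign (w \<cdot> x)\<close> with conditional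
  probability \<open>1 - \<eta>\<close> and \<open>- sign (w \<cdot> x)\<close> with conditional probability \<open>\<eta>\<close>: conditional
  probabilities given \<open>x\<close> are characterised by their integrals over the events \<open>x \<in> S\<close>.
\<close>

definition rcn_halfspace :: "nat \<Rightarrow> real \<Rightarrow> real \<Rightarrow> (point \<times> int) measure \<Rightarrow> bool" where
  "rcn_halfspace d \<eta> \<gamma> D \<longleftrightarrow>
     0 < \<eta> \<and> \<eta> < 1/2 \<and>
     prob_space D \<and> sets D = sets (example_space d) \<and>
     (\<exists>w\<in>unit_sphere d.
        measure D {z \<in> space D. \<bar>dot d w (fst z)\<bar> < \<gamma>} = 0 \<and>
        (\<forall>S\<in>sets (sphere_space d).
           measure D {z \<in> space D. fst z \<in> S \<and> snd z = sign (dot d w (fst z))} =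
             (1 - \<eta>) * measure D {z \<in> space D. fst z \<in> S} \<and>
           measure D {z \<in> space D. fst z \<in> S \<and> snd z = - sign (dot d w (fst z))} =
             \<eta> * measure D {z \<in> space D. fst z \<in> S}))"

definition misclass_error :: "(point \<times> int) measure \<Rightarrow> (point \<Rightarrow> int) \<Rightarrow> real" where
  "misclass_error D h = measure D {z \<in> space D. h (fst z) \<noteq> snd z}"


section \<open>Statistical query algorithms\<close>

text \<open>A query consists of the query function and the tolerance at which it is asked.\<close>

type_synonym 'z query = "('z \<Rightarrow> real) \<times> real"

definition stat_query :: "'z measure \<Rightarrow> 'z query \<Rightarrow> bool" where
  "stat_query Z q \<longleftrightarrow>
     fst q \<in> borel_measurable Z \<and> (\<forall>z\<in>space Z. fst q z \<in> {-1..1}) \<and> snd q > 0"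

text \<open>
  An oracle may choose its answer depending on the queries asked earlier in the run, so that
  repeating a query need not return the same value.
\<close>

type_synonym 'z answerer = "'z query list \<Rightarrow> 'z query \<Rightarrow> real"

definition stat_oracle :: "'z measure \<Rightarrow> 'z answerer \<Rightarrow> bool" where
  "stat_oracle D orc \<longleftrightarrow>
     (\<forall>hist q. stat_query D q \<longrightarrow> \<bar>orc hist q - (\<integral>z. fst q z \<partial>D)\<bar> \<le> snd q)"

text \<open>
  A deterministic adaptive algorithm is a well-founded decision tree: it either outputs a
  hypothesis, or asks a query and continues depending on the answer.
\<close>

datatype ('z, 'h) sq_tree =
    Output 'h
  | Query "'z query" "real \<Rightarrow> ('z, 'h) sq_tree"

primrec run_from :: "'z answerer \<Rightarrow> 'z query list \<Rightarrow> ('z, 'h) sq_tree \<Rightarrow> 'z query list \<times> 'h" where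
  "run_from orc hist (Output h) = (hist, h)"
| "run_from orc hist (Query q k) = run_from orc (hist @ [q]) (k (orc hist q))"

definition queries :: "'z answerer \<Rightarrow> ('z, 'h) sq_tree \<Rightarrow> 'z query list" where
  "queries orc A = fst (run_from orc [] A)"

definition final_hyp :: "'z answerer \<Rightarrow> ('z, 'h) sq_tree \<Rightarrow> 'h" where
  "final_hyp orc A = snd (run_from orc [] A)"

primrec well_formed :: "'z measure \<Rightarrow> 'h set \<Rightarrow> ('z, 'h) sq_tree \<Rightarrow> bool" where
  "well_formed Z H (Output h) \<longleftrightarrow> h \<in> H"
| "well_formed Z H (Query q k) \<longleftrightarrow> stat_query Z q \<and> (\<forall>v. well_formed Z H (k v))"

type_synonym halfspace_tree = "(point \<times> int, point \<Rightarrow> int) sq_tree"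

text \<open>
  A randomized algorithm is a probability distribution over deterministic ones. Its
  sigma-algebra is arbitrary: any algorithm drawing a random seed from some probability space
  is covered by pushing the distribution and the sigma-algebra of the seed forward.
\<close>

definition sq_algorithm :: "nat \<Rightarrow> halfspace_tree measure \<Rightarrow> bool" where
  "sq_algorithm d M \<longleftrightarrow>
     prob_space M \<and>
     (\<forall>A\<in>space M. well_formed (example_space d) (measurable (euclid d) (count_space {-1, 1})) A)"

text \<open>
  The success event is only required to contain a measurable event of probability at least
  \<open>9/10\<close>, since for an arbitrary oracle it need not itself be measurable.
\<close>

definition sq_learns :: "nat \<Rightarrow> real \<Rightarrow> real \<Rightarrow> real \<Rightarrow> halfspace_tree measure \<Rightarrow> bool" where
  "sq_learns d \<eta> \<gamma> \<epsilon> M \<longleftrightarrow>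
     sq_algorithm d M \<and>
     (\<forall>D orc. rcn_halfspace d \<eta> \<gamma> D \<and> stat_oracle D orc \<longrightarrow>
        (\<exists>E\<in>sets M. E \<subseteq> {A. misclass_error D (final_hyp orc A) \<le> \<eta> + \<epsilon>} \<and>
                    measure M E \<ge> 9/10))"

text \<open>
  For some distribution of the class and some valid oracle, the list of queries made by the
  algorithm satisfies \<open>P\<close> with nonzero probability over its internal randomness (the seeds for
  which it does are not contained in a null set).
\<close>

definition some_run ::
  "nat \<Rightarrow> real \<Rightarrow> real \<Rightarrow> halfspace_tree measure \<Rightarrow> ((point \<times> int) query list \<Rightarrow> bool) \<Rightarrow> bool" where
  "some_run d \<eta> \<gamma> M P \<longleftrightarrow>
     (\<exists>D orc. rcn_halfspace d \<eta> \<gamma> D \<and> stat_oracle D orc \<and>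
        \<not> (AE A in M. \<not> P (queries orc A)))"

end

theory Submission
  imports Defs "HOL-Real_Asymp.Real_Asymp"
begin

text \<open>
  Let \<open>m \<approx> 1/(2\<gamma>)\<close> be odd. Points \<open>x\<close> are, with probability \<open>12\<epsilon>\<close>, uniform on
  \<open>{-1, 1}\<^sup>m / sqrt m\<close>, and otherwise equal to a further basis vector, on which all halfspaces agree;
  the normals are \<open>(3/5 v, 4/5)\<close> with \<open>v \<in> {-1, 1}\<^sup>m / sqrt m\<close>. On the cube these are majority
  functions, so the margin is of order \<open>1/m\<close>, and error \<open>\<eta> + \<epsilon>\<close> requires correlation at least
  \<open>1/2\<close> with the majority in direction \<open>v\<close>. Two majorities have correlation at most
  \<open>4 \<bar>v \<bullet> v'\<bar>\<close>, and \<open>v \<bullet> v'\<close> concentrates at scale \<open>m powr (-1/2)\<close>; by Cauchy--Schwarz, a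
  bounded function correlates by more than \<open>8 \<gamma> powr (1/4 - c)\<close> with only an exponentially small
  fraction of the directions. So an oracle that answers as if the labels on the cube were fair
  coins is valid for almost all directions, along a run that does not depend on the direction,
  and the single hypothesis output there cannot be good for most of them.
\<close>

section \<open>Correlation of majority functions\<close>

text \<open>\<open>walk n f\<close> sums \<open>f\<close> over the end points of all \<open>2 ^ n\<close> walks of \<open>n\<close> steps \<open>1\<close> or \<open>-1\<close> from \<open>0\<close>.\<close>

primrec walk :: "nat \<Rightarrow> (int \<Rightarrow> real) \<Rightarrow> real" where
  "walk 0 f = f 0"
| "walk (Suc n) f = walk n (\<lambda>k. f (k + 1) + f (k - 1))"

section \<open>Walk sums: parity, linearity and end-point counts\<close>

text \<open>After \<open>n\<close> steps the position has the parity of \<open>n\<close>, so values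
  of \<open>f\<close> elsewhere never enter. This lets pointwise identities be checked on one parity
  class only.\<close>

lemma walk_cong_parity:
  assumes "\<And>k. even (k - int n) \<Longrightarrow> f k = g k"
  shows "walk n f = walk n g"
  using assms
proof (induction n arbitrary: f g)
  case (Suc n)
  have "walk n (\<lambda>k. f (k + 1) + f (k - 1)) = walk n (\<lambda>k. g (k + 1) + g (k - 1))"
  proof (rule Suc.IH)
    fix k :: int assume "even (k - int n)"
    then have "even (k + 1 - int (Suc n))" "even (k - 1 - int (Suc n))" by auto
    then show "f (k + 1) + f (k - 1) = g (k + 1) + g (k - 1)" using Suc.prems by presburger
  qed
  then show ?case by simp
qed simp

lemma walk_add: "walk n (\<lambda>k. f k + g k) = walk n f + walk n g"
proof (induction n arbitrary: f g)
  case (Suc n)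
  show ?case using Suc[of "\<lambda>k. f (k + 1) + f (k - 1)" "\<lambda>k. g (k + 1) + g (k - 1)"]
    by (simp add: algebra_simps)
qed simp

lemma walk_cmult: "walk n (\<lambda>k. c * f k) = c * walk n f"
proof (induction n arbitrary: f)
  case (Suc n)
  show ?case using Suc[of "\<lambda>k. f (k + 1) + f (k - 1)"] by (simp add: algebra_simps)
qed simp

lemma walk_diff: "walk n (\<lambda>k. f k - g k) = walk n f - walk n g"
  using walk_add[of n f "\<lambda>k. - 1 * g k"] walk_cmult[of n "-1" g] by simp

lemma walk_swap: "walk a (\<lambda>x. walk b (\<lambda>y. f x y)) = walk b (\<lambda>y. walk a (\<lambda>x. f x y))"
proof (induction a arbitrary: f)
  case (Suc a)
  have "walk (Suc a) (\<lambda>x. walk b (\<lambda>y. f x y)) =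
      walk a (\<lambda>x. walk b (\<lambda>y. f (x + 1) y + f (x - 1) y))"
    by (simp add: walk_add)
  also have "\<dots> = walk b (\<lambda>y. walk a (\<lambda>x. f (x + 1) y + f (x - 1) y))" by (rule Suc)
  finally show ?case by simp
qed simp

lemma abs_walk_le:
  assumes "\<And>k. \<bar>f k\<bar> \<le> c"
  shows "\<bar>walk n f\<bar> \<le> 2 ^ n * c"
  using assms
proof (induction n arbitrary: f c)
  case (Suc n)
  have "\<bar>walk n (\<lambda>k. f (k + 1) + f (k - 1))\<bar> \<le> 2 ^ n * (2 * c)"
  proof (rule Suc.IH)
    fix k show "\<bar>f (k + 1) + f (k - 1)\<bar> \<le> 2 * c"
      using Suc.prems[of "k + 1"] Suc.prems[of "k - 1"] by linarith
  qed
  then show ?case by simp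
qed simp

lemma walk_point_left: "j < - int n \<Longrightarrow> walk n (\<lambda>k. of_bool (k = j)) = 0"
proof (induction n arbitrary: j)
  case (Suc n)
  have "(\<lambda>k. of_bool (k + 1 = j) + of_bool (k - 1 = j)) =
     (\<lambda>k. of_bool (k = j - 1) + of_bool (k = j + 1) :: real)"
    by (auto simp: fun_eq_iff)
  with Suc.IH[of "j - 1"] Suc.IH[of "j + 1"] Suc.prems show ?case by (simp add: walk_add)
qed simp

lemma walk_point: "walk n (\<lambda>k. of_bool (k = 2 * int i - int n)) = real (n choose i)"
proof (induction n arbitrary: i)
  case (Suc n)
  have "(\<lambda>k. of_bool (k + 1 = 2 * int i - int (Suc n)) + of_bool (k - 1 = 2 * int i - int (Suc n))) =
     (\<lambda>k. of_bool (k = 2 * (int i - 1) - int n) + of_bool (k = 2 * int i - int n) :: real)"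
    by (auto simp: fun_eq_iff)
  then have "walk (Suc n) (\<lambda>k. of_bool (k = 2 * int i - int (Suc n))) =
      walk n (\<lambda>k. of_bool (k = 2 * (int i - 1) - int n)) + real (n choose i)"
    by (simp add: walk_add Suc.IH)
  also have "\<dots> = real (Suc n choose i)"
  \<comment> \<open>Pascal's rule. For \<open>i = 0\<close> the left neighbour
    \<open>- 2 - int n\<close> is out of reach of \<open>n\<close> steps, and no natural number
    \<open>i - 1\<close> denotes it.\<close>
  proof (cases i)
    case 0
    then show ?thesis using walk_point_left[of "- 2 - int n" n] by simp
  next
    case (Suc j)
    then show ?thesis using Suc.IH[of j] by simp
  qed
  finally show ?case .
next
  case 0
  then show ?case by (cases i) auto
qed

section \<open>Return counts\<close>

text \<open>Consecutive central binomials have ratio \<open>2 * (2 * k + 1) / (k + 1)\<close>. The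
  root of \<open>2 * k + 1\<close>, the number of steps plus one, closes the induction by the AM-GM
  inequality \<open>s\<close>.\<close>

lemma central_binomial_upper_bound: "real (2 * k choose k) \<le> 4 ^ k / sqrt (2 * real k + 1)"
proof (induction k)
  case (Suc k)
  let ?c = "real (2 * k choose k)" and ?d = "real (2 * Suc k choose Suc k)"
  have e: "(real k + 1) * ?d = 2 * (2 * real k + 1) * ?c"
  proof -
    have 1: "Suc k * (Suc (Suc (2 * k)) choose Suc k) = Suc (Suc (2 * k)) * (Suc (2 * k) choose k)"
      by (rule Suc_times_binomial)
    have 2: "Suc (2 * k) choose k = Suc (2 * k) choose Suc k"
      using binomial_symmetric[of k "Suc (2 * k)"] by (simp add: algebra_simps)
    have 3: "Suc k * (Suc (2 * k) choose Suc k) = Suc (2 * k) * (2 * k choose k)"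
      by (rule Suc_times_binomial)
    have "Suc k * (2 * Suc k choose Suc k) = 2 * (Suc k * (Suc (2 * k) choose Suc k))"
      using 1 unfolding 2 by (simp only: mult_Suc_right add_2_eq_Suc mult.assoc[symmetric])
    then have "Suc k * (2 * Suc k choose Suc k) = 2 * Suc (2 * k) * (2 * k choose k)"
      unfolding 3 by (simp only: mult.assoc)
    then have "real (Suc k * (2 * Suc k choose Suc k)) = real (2 * Suc (2 * k) * (2 * k choose k))"
      by (rule arg_cong)
    then show ?thesis unfolding of_nat_mult by (simp add: algebra_simps)
  qed
  have s: "sqrt ((2 * real k + 1) * (2 * real k + 3)) \<le> 2 * (real k + 1)"
    by (rule real_le_lsqrt) (auto simp: power2_eq_square algebra_simps)
  have "(real k + 1) * ?d \<le> 2 * (2 * real k + 1) * (4 ^ k / sqrt (2 * real k + 1))"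
    unfolding e using Suc by (intro mult_left_mono) auto
  also have "\<dots> = 2 * 4 ^ k * sqrt (2 * real k + 1)"
    by (simp add: real_div_sqrt field_simps)
  also have "\<dots> = 2 * 4 ^ k * sqrt ((2 * real k + 1) * (2 * real k + 3)) / sqrt (2 * real k + 3)"
    by (simp add: real_sqrt_mult)
  also have "\<dots> \<le> 2 * 4 ^ k * (2 * (real k + 1)) / sqrt (2 * real k + 3)"
    using s by (intro divide_right_mono mult_left_mono) auto
  also have "\<dots> = (real k + 1) * (4 ^ Suc k / sqrt (2 * real (Suc k) + 1))"
    by (simp add: algebra_simps)
  finally show ?case by (subst (asm) mult_le_cancel_left_pos) auto
qed simp

definition return_count :: "nat \<Rightarrow> real" where
  "return_count n = walk n (\<lambda>k. of_bool (k = 0))"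

lemma return_count_le: "return_count n \<le> 2 ^ n / sqrt (real n + 1)"
proof (cases "even n")
  case True
  then obtain k where k: "n = 2 * k" by blast
  have "return_count n = real (2 * k choose k)"
    using walk_point[of "2 * k" k] by (simp add: return_count_def k)
  with central_binomial_upper_bound[of k] show ?thesis by (simp add: k power_mult)
next
  case False
  have "return_count n = walk n (\<lambda>k. 0 * 0)"
    unfolding return_count_def by (rule walk_cong_parity) (use False in auto)
  also have "\<dots> = 0" using walk_cmult[of n 0 "\<lambda>_. 0"] by simp
  finally show ?thesis by simp
qed

lemma return_count_nonneg: "0 \<le> return_count n"
proof -
  have "0 \<le> walk n f" if "\<And>k. 0 \<le> f k" for f
    using that by (induction n arbitrary: f) auto
  then show ?thesis by (simp add: return_count_def)
qed

text \<open>
  For two directions agreeing in \<open>a\<close> and differing in \<open>b\<close> coordinates, with partial sums \<open>x\<close> and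
  \<open>y\<close> over these, the two majorities are the signs of \<open>x + y\<close> and \<open>x - y\<close>.
\<close>

definition majority_corr :: "nat \<Rightarrow> nat \<Rightarrow> real" where
  "majority_corr a b = walk a (\<lambda>x. walk b (\<lambda>y. of_int (sgn (x + y) * sgn (x - y))))"

section \<open>Changing the correlation one coordinate at a time\<close>

text \<open>Exchanging \<open>x\<close> and \<open>y\<close> keeps \<open>x + y\<close> and negates
  \<open>x - y\<close>.\<close>

lemma majority_corr_swap: "majority_corr b a = - majority_corr a b"
proof -
  have "majority_corr b a = walk a (\<lambda>y. walk b (\<lambda>x. of_int (sgn (x + y) * sgn (x - y))))"
    unfolding majority_corr_def by (rule walk_swap)
  also have "(\<lambda>y x. of_int (sgn (x + y) * sgn (x - y))) =
      (\<lambda>x y. - 1 * (of_int (sgn (x + y) * sgn (x - y)) :: real))"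
    by (intro ext) (auto simp: sgn_if)
  finally show ?thesis by (simp only: walk_cmult majority_corr_def)
qed

text \<open>One extra step is taken either in \<open>x\<close> or in \<open>y\<close>. The
  difference of the summands factors into a discrete derivative of \<open>sgn\<close> at
  \<open>x + y\<close> and one at \<open>x - y\<close>; both are nonzero only for
  \<open>x = y = 0\<close>, that is, if both walks return.\<close>

lemma majority_corr_step:
  assumes "even (a + b)"
  shows "majority_corr (Suc a) b - majority_corr a (Suc b) = 4 * return_count a * return_count b"
proof -
  let ?s = "\<lambda>x y. real_of_int (sgn (x + y) * sgn (x - y))"
  have pointwise: "?s (x + 1) y + ?s (x - 1) y - (?s x (y + 1) + ?s x (y - 1)) =
      4 * (of_bool (x = 0) * of_bool (y = 0))" if "even (x - int a)" "even (y - int b)" for x y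
  proof -
    \<comment> \<open>At even arguments, a sign changes under a shift by one only at \<open>0\<close>.\<close>
    have e: "even (x - y)" "even (x + y)" using that assms by presburger+
    have two: "sgn (p + 1) - sgn (p - 1) = 2 * of_bool (p = 0)" if "even p" for p :: int
      using that by (cases "p = 1"; cases "p = -1") (auto simp: sgn_if)
    have "?s (x + 1) y + ?s (x - 1) y - (?s x (y + 1) + ?s x (y - 1)) =
      of_int ((sgn (x + y + 1) - sgn (x + y - 1)) * (sgn (x - y + 1) - sgn (x - y - 1)))"
      by (simp add: algebra_simps)
    also have "\<dots> = 4 * (of_bool (x + y = 0) * of_bool (x - y = 0))"
      using two[OF e(1)] two[OF e(2)] by simp
    also have "\<dots> = 4 * (of_bool (x = 0) * of_bool (y = 0))" by auto
    finally show ?thesis .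
  qed
  have "majority_corr (Suc a) b - majority_corr a (Suc b) =
      walk a (\<lambda>x. walk b (\<lambda>y. ?s (x + 1) y + ?s (x - 1) y - (?s x (y + 1) + ?s x (y - 1))))"
    by (simp only: majority_corr_def walk.simps walk_add walk_diff)
  also have "\<dots> = walk a (\<lambda>x. walk b (\<lambda>y. 4 * (of_bool (x = 0) * of_bool (y = 0))))"
    by (intro walk_cong_parity pointwise)
  also have "\<dots> = 4 * walk a (\<lambda>x. return_count b * of_bool (x = 0))"
    by (simp only: walk_cmult return_count_def[symmetric] mult.commute[of _ "return_count b"])
  also have "\<dots> = 4 * return_count a * return_count b"
    by (simp only: walk_cmult return_count_def[symmetric] mult_ac)
  finally show ?thesis .
qed

lemma majority_corr_step_bounds:
  assumes "even (a + b)" "k \<le> a" "k \<le> b"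
  shows "0 \<le> majority_corr (Suc a) b - majority_corr a (Suc b)"
    and "majority_corr (Suc a) b - majority_corr a (Suc b) \<le> 4 * 2 ^ (a + b) / (real k + 1)"
proof -
  note e = majority_corr_step[OF assms(1)]
  show "0 \<le> majority_corr (Suc a) b - majority_corr a (Suc b)"
    unfolding e by (simp add: return_count_nonneg)
  have r: "return_count n \<le> 2 ^ n / sqrt (real k + 1)" if "k \<le> n" for n
  proof -
    have "return_count n \<le> 2 ^ n / sqrt (real n + 1)" by (rule return_count_le)
    also have "\<dots> \<le> 2 ^ n / sqrt (real k + 1)"
      using that by (intro divide_left_mono mult_pos_pos) (auto intro: add_nonneg_pos)
    finally show ?thesis .
  qed
  have "return_count a * return_count b \<le> (2 ^ a / sqrt (real k + 1)) * (2 ^ b / sqrt (real k + 1))"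
    using assms by (intro mult_mono r return_count_nonneg) auto
  also have "\<dots> = 2 ^ (a + b) / (real k + 1)" by (simp add: power_add)
  finally show "majority_corr (Suc a) b - majority_corr a (Suc b) \<le> 4 * 2 ^ (a + b) / (real k + 1)"
    unfolding e by simp
qed

text \<open>Telescoping over single coordinates moved from the disagreeing to the agreeing ones.
  Both arguments stay at least \<open>b\<close>, so each step is at most \<open>K\<close>; the power
  belongs to a total smaller by one, which turns the factor 4 into 2. At \<open>j = n\<close> the
  arguments are exchanged.\<close>

lemma majority_corr_chain:
  fixes b n :: nat
  defines "K \<equiv> 2 * 2 ^ (b + b + n) / (real b + 1)"
  assumes "odd (b + b + n)" "j \<le> n"
  shows "0 \<le> majority_corr (b + j) (b + n - j) - majority_corr b (b + n) \<and>
    majority_corr (b + j) (b + n - j) - majority_corr b (b + n) \<le> real j * K"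
  using assms(3)
proof (induction j)
  case (Suc j)
  obtain i where i: "n = Suc (j + i)" using less_imp_Suc_add[of j n] Suc.prems by auto
  have ev: "even ((b + j) + (b + i))" using assms(2) by (simp add: i)
  have p: "4 * 2 ^ ((b + j) + (b + i)) / (real b + 1) = K" by (simp add: i power_add K_def)
  note st = majority_corr_step_bounds[OF ev, of b, simplified p]
  have "b + n - j = Suc (b + i)" "b + n - Suc j = b + i" by (auto simp: i)
  then show ?case using Suc st by (simp add: algebra_simps)
qed simp

lemma abs_majority_corr_le_1: "\<bar>majority_corr a b\<bar> \<le> 2 ^ (a + b)"
proof -
  have "\<bar>majority_corr a b\<bar> \<le> 2 ^ a * (2 ^ b * 1)"
    unfolding majority_corr_def by (intro abs_walk_le) (auto simp: sgn_if)
  then show ?thesis by (simp add: power_add)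
qed

lemma abs_majority_corr_le:
  assumes "odd (a + b)"
  shows "\<bar>majority_corr a b\<bar> \<le> 2 ^ (a + b) * (4 * \<bar>real a - real b\<bar> / real (a + b))"
proof -
  have *: "\<bar>majority_corr a b\<bar> \<le> 2 ^ (a + b) * (4 * (real a - real b) / real (a + b))"
    if "b \<le> a" "odd (a + b)" for a b
  proof -
    obtain n where n: "a = b + n" using \<open>b \<le> a\<close> le_Suc_ex by blast
    have pos: "real (a + b) > 0" using that(2) by (cases "a + b") auto
    \<comment> \<open>By antisymmetry, the chain from \<open>(b, a)\<close> to \<open>(a, b)\<close>
      changes the correlation by twice its final value.\<close>
    have "2 * \<bar>majority_corr a b\<bar> = \<bar>majority_corr a b - majority_corr b a\<bar>" using majority_corr_swap[of b a] by simp
    also have "\<dots> \<le> real n * (2 * 2 ^ (a + b) / (real b + 1))"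
      using majority_corr_chain[of b n n] that(2) by (simp add: n ac_simps)
    also have "\<dots> = 2 * (2 ^ (a + b) * (real n / (real b + 1)))" by simp
    finally have m: "\<bar>majority_corr a b\<bar> \<le> 2 ^ (a + b) * (real n / (real b + 1))" by linarith
    show ?thesis
    \<comment> \<open>If \<open>b\<close> is at least a quarter of the total, \<open>b + 1\<close>
      is comparable to \<open>a + b\<close>; otherwise the claimed bound exceeds the trivial
      one.\<close>
    proof (cases "4 * b \<ge> a + b")
      case True
      have "real n / (real b + 1) \<le> 4 * real n / real (a + b)"
      proof -
        have "real (a + b) \<le> 4 * (real b + 1)" using True by (simp flip: of_nat_add of_nat_mult)
        then have "real n * real (a + b) \<le> real n * (4 * (real b + 1))" by (rule mult_left_mono) simp
        then show ?thesis using pos by (simp add: field_simps)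
      qed
      then have "2 ^ (a + b) * (real n / (real b + 1)) \<le> 2 ^ (a + b) * (4 * real n / real (a + b))"
        by (intro mult_left_mono) auto
      with m show ?thesis by (simp add: n)
    next
      case False
      then have "1 \<le> 4 * (real a - real b) / real (a + b)" using pos by (simp add: field_simps)
      then have "2 ^ (a + b) * 1 \<le> 2 ^ (a + b) * (4 * (real a - real b) / real (a + b))"
        by (intro mult_left_mono) auto
      with abs_majority_corr_le_1[of a b] show ?thesis by simp
    qed
  qed
  show ?thesis
  proof (cases "b \<le> a")
    case True
    then show ?thesis using *[OF True assms] by simp
  next
    case False
    then have "\<bar>majority_corr b a\<bar> \<le> 2 ^ (b + a) * (4 * (real b - real a) / real (b + a))"
      using assms by (intro *) (auto simp: add.commute)
    then show ?thesis using False majority_corr_swap[of a b] by (simp add: add.commute)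
  qed
qed

section \<open>Few majorities correlate with a bounded function\<close>

lemma cosh_le_exp_half_square: "exp x + exp (- x) \<le> 2 * exp (x\<^sup>2 / 2)" for x :: real
proof -
  have *: "exp x + exp (- x) \<le> 2 * exp (x\<^sup>2 / 2)" if "x > 0" for x :: real
  proof -
    have p: "1 + exp (2 * x) > 0" by (intro add_pos_pos) auto
    \<comment> \<open>The two-point case of Hoeffding's lemma, with weight 1/2 and gap
      \<open>2 * x\<close>.\<close>
    have "- (2 * x) * (1/2) + ln (1 + (1/2) * (exp (2 * x) - 1)) \<le> (2 * x)\<^sup>2 / 8"
      by (rule Hoeffdings_lemma_aux) (use that in auto)
    then have "ln ((1 + exp (2 * x)) / 2) \<le> x + x\<^sup>2 / 2"
      by (simp add: field_simps power2_eq_square)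
    then have "exp (ln ((1 + exp (2 * x)) / 2)) \<le> exp (x + x\<^sup>2 / 2)" by simp
    then have "(1 + exp (2 * x)) / 2 \<le> exp (x + x\<^sup>2 / 2)" using p by simp
    then have "exp (- x) * (1 + exp (2 * x)) \<le> exp (- x) * (2 * exp (x + x\<^sup>2 / 2))"
      by (intro mult_left_mono) auto
    then show ?thesis by (simp add: algebra_simps flip: exp_add)
  qed
  show ?thesis using *[of x] *[of "- x"] by (cases "x > 0"; cases "x = 0") auto
qed

text \<open>Subsets of \<open>{..<m}\<close> encode the vertices of the cube.\<close>

definition sign_vec :: "nat set \<Rightarrow> nat \<Rightarrow> int" where
  "sign_vec S i = (if i \<in> S then - 1 else 1)"

definition sign_inner :: "nat \<Rightarrow> nat set \<Rightarrow> nat set \<Rightarrow> int" where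
  "sign_inner m V S = (\<Sum>i<m. sign_vec V i * sign_vec S i)"

definition majority :: "nat \<Rightarrow> nat set \<Rightarrow> nat set \<Rightarrow> real" where
  "majority m V S = of_int (sgn (sign_inner m V S))"

section \<open>Sums over the cube as walk sums\<close>

lemma sum_Pow_insert:
  assumes "finite A" "a \<notin> A"
  shows "(\<Sum>S\<in>Pow (insert a A). f S) = (\<Sum>S\<in>Pow A. f S + f (insert a S))"
proof -
  have "(\<Sum>S\<in>Pow (insert a A). f S) = (\<Sum>S\<in>Pow A. f S) + (\<Sum>S\<in>insert a ` Pow A. f S)"
    unfolding Pow_insert using assms by (intro sum.union_disjoint) auto
  also have "(\<Sum>S\<in>insert a ` Pow A. f S) = (\<Sum>S\<in>Pow A. f (insert a S))"
    using assms by (subst sum.reindex) (auto simp: inj_on_def)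
  finally show ?thesis by (simp add: sum.distrib)
qed

text \<open>Multiplying by the fixed signs of \<open>V\<close> only permutes the cube, so the sum
  over \<open>A\<close> is a walk whatever \<open>V\<close> is. Keeping \<open>S \<inter> B\<close>
  as a parameter lets a second walk run over \<open>B\<close>.\<close>

lemma sum_signs_walk_param:
  assumes "finite A" "finite B" "A \<inter> B = {}"
  shows "(\<Sum>S\<in>Pow (A \<union> B). \<phi> (\<Sum>i\<in>A. sign_vec V i * sign_vec S i) (S \<inter> B)) =
    walk (card A) (\<lambda>x. \<Sum>T\<in>Pow B. \<phi> x T)"
  using assms(1,3)
proof (induction A arbitrary: \<phi> rule: finite_induct)
  case empty
  have "(\<Sum>S\<in>Pow B. \<phi> 0 (S \<inter> B)) = (\<Sum>T\<in>Pow B. \<phi> 0 T)"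
    by (intro sum.cong) (auto simp: Int_absorb2)
  then show ?case by simp
next
  case (insert a A)
  have a: "a \<notin> A \<union> B" using insert by auto
  let ?X = "\<lambda>S. \<Sum>i\<in>A. sign_vec V i * sign_vec S i"
  have "(\<Sum>S\<in>Pow (insert a A \<union> B). \<phi> (\<Sum>i\<in>insert a A. sign_vec V i * sign_vec S i) (S \<inter> B)) =
      (\<Sum>S\<in>Pow (A \<union> B). \<phi> (sign_vec V a + ?X S) (S \<inter> B) + \<phi> (- sign_vec V a + ?X S) (S \<inter> B))"
    unfolding Un_insert_left using a insert.hyps assms(2)
  proof (subst sum_Pow_insert, simp, simp, intro sum.cong refl)
    fix S assume S: "S \<in> Pow (A \<union> B)"
    have "?X (insert a S) = ?X S"
      using insert.hyps by (intro sum.cong) (auto simp: sign_vec_def)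
    moreover have "insert a S \<inter> B = S \<inter> B" "a \<notin> S" using a S by auto
    ultimately show "\<phi> (\<Sum>i\<in>insert a A. sign_vec V i * sign_vec S i) (S \<inter> B) +
        \<phi> (\<Sum>i\<in>insert a A. sign_vec V i * sign_vec (insert a S) i) (insert a S \<inter> B) =
        \<phi> (sign_vec V a + ?X S) (S \<inter> B) + \<phi> (- sign_vec V a + ?X S) (S \<inter> B)"
      using insert.hyps by (simp add: sign_vec_def)
  qed
  \<comment> \<open>Either sign of \<open>V\<close> at \<open>a\<close> gives the same two summands,
    possibly in the other order.\<close>
  also have "\<dots> = (\<Sum>S\<in>Pow (A \<union> B). \<phi> (?X S + 1) (S \<inter> B) + \<phi> (?X S - 1) (S \<inter> B))"
    by (intro sum.cong) (auto simp: sign_vec_def add.commute)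
  also have "\<dots> = walk (card A) (\<lambda>x. \<Sum>T\<in>Pow B. \<phi> (x + 1) T + \<phi> (x - 1) T)"
    using insert.prems by (intro insert.IH) auto
  finally show ?case using insert.hyps by (simp add: sum.distrib)
qed

lemma sum_signs_walk:
  assumes "finite A"
  shows "(\<Sum>S\<in>Pow A. f (\<Sum>i\<in>A. sign_vec V i * sign_vec S i)) = walk (card A) f"
  using sum_signs_walk_param[OF assms, of "{}" "\<lambda>x T. f x" V] by simp

lemma sum_signs_walk_2:
  assumes "finite A" "finite B" "A \<inter> B = {}"
  shows "(\<Sum>S\<in>Pow (A \<union> B). f (\<Sum>i\<in>A. sign_vec V i * sign_vec S i) (\<Sum>i\<in>B. sign_vec V i * sign_vec S i)) =
    walk (card A) (\<lambda>x. walk (card B) (f x))"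
proof -
  have "(\<Sum>i\<in>B. sign_vec V i * sign_vec S i) = (\<Sum>i\<in>B. sign_vec V i * sign_vec (S \<inter> B) i)" for S
    by (intro sum.cong) (auto simp: sign_vec_def)
  then have "(\<Sum>S\<in>Pow (A \<union> B). f (\<Sum>i\<in>A. sign_vec V i * sign_vec S i) (\<Sum>i\<in>B. sign_vec V i * sign_vec S i)) =
      (\<Sum>S\<in>Pow (A \<union> B). f (\<Sum>i\<in>A. sign_vec V i * sign_vec S i) (\<Sum>i\<in>B. sign_vec V i * sign_vec (S \<inter> B) i))"
    by simp
  also have "\<dots> = walk (card A) (\<lambda>x. \<Sum>T\<in>Pow B. f x (\<Sum>i\<in>B. sign_vec V i * sign_vec T i))"
    by (rule sum_signs_walk_param[OF assms, of "\<lambda>x T. f x (\<Sum>i\<in>B. sign_vec V i * sign_vec T i)"])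
  finally show ?thesis using assms(2) by (simp add: sum_signs_walk)
qed

text \<open>With \<open>x\<close> and \<open>y\<close> the partial sums over the agreeing set
  \<open>P\<close> and the disagreeing set \<open>Q\<close>, the inner products of \<open>S\<close>
  with \<open>V\<close> and \<open>U\<close> are \<open>x + y\<close> and \<open>x - y\<close>. So
  the sum is \<open>majority_corr (card P) (card Q)\<close>, while \<open>sign_inner m V U\<close>
  is \<open>card P - card Q\<close>.\<close>

lemma correlation_majorities_le:
  assumes "odd m"
  shows "\<bar>\<Sum>S\<in>Pow {..<m}. majority m V S * majority m U S\<bar> \<le> 2 ^ m * (4 * \<bar>real_of_int (sign_inner m V U)\<bar> / real m)"
proof -
  define P where "P = {i. i < m \<and> sign_vec V i = sign_vec U i}"
  define Q where "Q = {i. i < m \<and> sign_vec V i \<noteq> sign_vec U i}"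
  have PQ: "finite P" "finite Q" "P \<inter> Q = {}" "P \<union> Q = {..<m}" by (auto simp: P_def Q_def)
  have split: "(\<Sum>i<m. f i) = (\<Sum>i\<in>P. f i) + (\<Sum>i\<in>Q. f i)" for f :: "nat \<Rightarrow> int"
    using sum.union_disjoint[OF PQ(1-3), of f] PQ(4) by simp
  have V: "sign_inner m V S = (\<Sum>i\<in>P. sign_vec V i * sign_vec S i) + (\<Sum>i\<in>Q. sign_vec V i * sign_vec S i)" for S
    by (simp add: sign_inner_def split)
  have U: "sign_inner m U S = (\<Sum>i\<in>P. sign_vec V i * sign_vec S i) - (\<Sum>i\<in>Q. sign_vec V i * sign_vec S i)" for S
  proof -
    have "(\<Sum>i\<in>P. sign_vec U i * sign_vec S i) = (\<Sum>i\<in>P. sign_vec V i * sign_vec S i)"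
      by (intro sum.cong) (auto simp: P_def)
    moreover have "(\<Sum>i\<in>Q. sign_vec U i * sign_vec S i) = (\<Sum>i\<in>Q. - (sign_vec V i * sign_vec S i))"
      by (intro sum.cong) (auto simp: Q_def sign_vec_def split: if_splits)
    ultimately show ?thesis by (simp add: sign_inner_def split sum_negf)
  qed
  have VU: "sign_inner m V U = int (card P) - int (card Q)"
  proof -
    have "(\<Sum>i\<in>P. sign_vec V i * sign_vec U i) = (\<Sum>i\<in>P. 1)"
      by (intro sum.cong) (auto simp: P_def sign_vec_def split: if_splits)
    moreover have "(\<Sum>i\<in>Q. sign_vec V i * sign_vec U i) = (\<Sum>i\<in>Q. - 1)"
      by (intro sum.cong) (auto simp: Q_def sign_vec_def split: if_splits)
    ultimately show ?thesis by (simp add: sign_inner_def split)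
  qed
  have m: "card P + card Q = m" using card_Un_disjoint[OF PQ(1-3)] PQ(4) by simp
  have "(\<Sum>S\<in>Pow {..<m}. majority m V S * majority m U S) = majority_corr (card P) (card Q)"
    using sum_signs_walk_2[OF PQ(1-3), of "\<lambda>x y. of_int (sgn (x + y) * sgn (x - y))" V]
    unfolding majority_def U V majority_corr_def PQ(4) by simp
  then show ?thesis using abs_majority_corr_le[of "card P" "card Q"] assms by (simp add: m VU)
qed

section \<open>Tail bound for inner products of cube vertices\<close>

lemma walk_exp: "walk n (\<lambda>k. exp (l * of_int k)) = (exp l + exp (- l)) ^ n"
proof (induction n)
  case (Suc n)
  have "(\<lambda>k. exp (l * of_int (k + 1)) + exp (l * of_int (k - 1))) =
      (\<lambda>k. (exp l + exp (- l)) * exp (l * of_int k))"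
    by (auto simp: fun_eq_iff algebra_simps simp flip: exp_add)
  then show ?case by (simp only: walk.simps walk_cmult Suc power_Suc)
qed simp

lemma card_sign_inner_gt:
  assumes "m > 0" "t \<ge> 0"
  shows "real (card {U\<in>Pow {..<m}. t < \<bar>real_of_int (sign_inner m V U)\<bar>}) \<le>
    2 ^ m * (2 * exp (- t\<^sup>2 / (2 * real m)))" (is "real (card ?B) \<le> _")
proof -
  \<comment> \<open>Chernoff's method: \<open>l\<close> minimises the exponent
    \<open>m * l\<^sup>2 / 2 - l * t\<close>.\<close>
  define l where "l = t / real m"
  have l: "l \<ge> 0" using assms by (simp add: l_def)
  have gen: "(\<Sum>U\<in>Pow {..<m}. exp (c * real_of_int (sign_inner m V U))) = (exp c + exp (- c)) ^ m" for c
    using sum_signs_walk[of "{..<m}" "\<lambda>k. exp (c * real_of_int k)" V] by (simp add: sign_inner_def walk_exp)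
  have "real (card ?B) * exp (l * t) = (\<Sum>U\<in>?B. exp (l * t))" by simp
  also have "\<dots> \<le> (\<Sum>U\<in>?B. exp (l * real_of_int (sign_inner m V U)) + exp (- l * real_of_int (sign_inner m V U)))"
  proof (intro sum_mono)
    fix U assume U: "U \<in> ?B"
    define z where "z = real_of_int (sign_inner m V U)"
    have "l * t \<le> l * \<bar>z\<bar>" using U l by (intro mult_left_mono) (auto simp: z_def)
    then have "exp (l * t) \<le> exp (l * \<bar>z\<bar>)" by simp
    also have "\<dots> \<le> exp (l * z) + exp (- l * z)" by (cases "z \<ge> 0") auto
    finally show "exp (l * t) \<le> exp (l * z) + exp (- l * z)" .
  qed
  also have "\<dots> \<le> (\<Sum>U\<in>Pow {..<m}. exp (l * real_of_int (sign_inner m V U)) + exp (- l * real_of_int (sign_inner m V U)))"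
    by (intro sum_mono2) (auto intro: add_nonneg_nonneg)
  also have "\<dots> = 2 * (exp l + exp (- l)) ^ m"
    unfolding sum.distrib gen by (simp add: add.commute)
  also have "\<dots> \<le> 2 * (2 * exp (l\<^sup>2 / 2)) ^ m"
    using cosh_le_exp_half_square[of l] by (intro mult_left_mono power_mono add_nonneg_nonneg) auto
  also have "\<dots> = 2 ^ m * (2 * exp (real m * (l\<^sup>2 / 2)))"
    unfolding power_mult_distrib exp_of_nat_mult by simp
  finally have "real (card ?B) \<le> 2 ^ m * (2 * exp (real m * (l\<^sup>2 / 2))) / exp (l * t)"
    by (simp add: field_simps)
  also have "\<dots> = 2 ^ m * (2 * exp (real m * (l\<^sup>2 / 2) - l * t))" by (simp add: exp_diff)
  also have "real m * (l\<^sup>2 / 2) - l * t = - t\<^sup>2 / (2 * real m)"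
    using assms(1) by (simp add: l_def power2_eq_square field_simps)
  finally show ?thesis .
qed

section \<open>Second moment bound\<close>

lemma abs_majority_le_1: "\<bar>majority m V S\<bar> \<le> 1"
  by (simp add: majority_def sgn_if)

text \<open>Cauchy--Schwarz bounds the total correlation of \<open>g\<close> with the directions in
  \<open>?B\<close> by the square sum of \<open>M\<close>, the sum of their majorities. That expands
  into pair correlations: relative to \<open>2 ^ m\<close>, pairs with inner product at most
  \<open>t\<close> cost \<open>4 * t / m\<close>, and the others, few by the tail bound, cost at
  most 1.\<close>

lemma card_correlated_majority:
  assumes m: "odd m" and "\<theta> \<ge> 0" "t \<ge> 0"
    and g: "\<And>S. S \<in> Pow {..<m} \<Longrightarrow> \<bar>g S\<bar> \<le> 1"
  shows "real (card {V\<in>Pow {..<m}. (\<Sum>S\<in>Pow {..<m}. g S * majority m V S) > \<theta> * 2 ^ m}) *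
      (\<theta>\<^sup>2 - 4 * t / real m) \<le> 2 ^ m * (2 * exp (- t\<^sup>2 / (2 * real m)))"
    (is "real (card ?B) * _ \<le> 2 ^ m * ?e")
proof (cases "card ?B = 0")
  case False
  let ?N = "2 ^ m :: real" and ?C = "Pow {..<m}"
  have mpos: "m > 0" using m by (cases m) auto
  have fin: "finite ?B" by auto
  have N: "real (card ?C) = ?N" by (simp add: card_Pow)
  define M where "M S = (\<Sum>V\<in>?B. majority m V S)" for S
  have M2: "(\<Sum>S\<in>?C. (M S)\<^sup>2) \<le> real (card ?B) * (?N * (real (card ?B) * (4 * t / real m) + ?N * ?e))"
  proof -
    have "(\<Sum>S\<in>?C. (M S)\<^sup>2) = (\<Sum>V\<in>?B. \<Sum>U\<in>?B. \<Sum>S\<in>?C. majority m V S * majority m U S)"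
      unfolding M_def power2_eq_square sum_product
      by (rule trans[OF sum.swap]) (intro sum.cong refl sum.swap)
    also have "\<dots> \<le> (\<Sum>V\<in>?B. ?N * (real (card ?B) * (4 * t / real m) + ?N * ?e))"
    proof (intro sum_mono)
      fix V
      let ?T = "{U\<in>Pow {..<m}. t < \<bar>real_of_int (sign_inner m V U)\<bar>}"
      have "(\<Sum>U\<in>?B. \<Sum>S\<in>?C. majority m V S * majority m U S) \<le>
          (\<Sum>U\<in>?B. ?N * (4 * t / real m) + (if U \<in> ?T then ?N else 0))"
      proof (intro sum_mono)
        fix U assume U: "U \<in> ?B"
        show "(\<Sum>S\<in>?C. majority m V S * majority m U S) \<le> ?N * (4 * t / real m) + (if U \<in> ?T then ?N else 0)"
        proof (cases "U \<in> ?T")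
          case True
          have "(\<Sum>S\<in>?C. majority m V S * majority m U S) \<le> (\<Sum>S\<in>?C. 1)"
          proof (intro sum_mono)
            fix S
            have "\<bar>majority m V S * majority m U S\<bar> \<le> 1"
              unfolding abs_mult by (intro mult_le_one abs_majority_le_1) auto
            then show "majority m V S * majority m U S \<le> 1" by linarith
          qed
          moreover have "0 \<le> ?N * (4 * t / real m)" using assms by auto
          ultimately show ?thesis using True N by simp
        next
          case False
          then have "\<bar>real_of_int (sign_inner m V U)\<bar> \<le> t" using U by auto
          then have "?N * (4 * \<bar>real_of_int (sign_inner m V U)\<bar> / real m) \<le> ?N * (4 * t / real m)"
            by (intro mult_left_mono divide_right_mono) auto
          then show ?thesis unfolding if_not_P[OF False] using correlation_majorities_le[OF m, of V U] by linarith
        qed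
      qed
      also have "\<dots> = ?N * (real (card ?B) * (4 * t / real m)) + ?N * real (card (?B \<inter> ?T))"
        unfolding sum.distrib sum.If_cases[OF fin] by (simp add: Int_def)
      also have "\<dots> \<le> ?N * (real (card ?B) * (4 * t / real m)) + ?N * (?N * ?e)"
      proof -
        have "real (card (?B \<inter> ?T)) \<le> real (card ?T)"
          by (intro of_nat_mono card_mono) auto
        also have "\<dots> \<le> ?N * ?e" by (rule card_sign_inner_gt[OF mpos assms(3)])
        finally show ?thesis by (intro add_left_mono mult_left_mono) auto
      qed
      finally show "(\<Sum>U\<in>?B. \<Sum>S\<in>?C. majority m V S * majority m U S) \<le>
          ?N * (real (card ?B) * (4 * t / real m) + ?N * ?e)"
        by (simp only: distrib_left)
    qed
    finally show ?thesis by simp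
  qed
  \<comment> \<open>All correlations counted in \<open>?B\<close> are positive, so they add up
    without cancellation.\<close>
  have "real (card ?B) * (\<theta> * ?N) \<le> (\<Sum>V\<in>?B. \<Sum>S\<in>?C. g S * majority m V S)"
    using sum_mono[of ?B "\<lambda>_. \<theta> * ?N" "\<lambda>V. \<Sum>S\<in>?C. g S * majority m V S"] by auto
  also have "\<dots> = (\<Sum>S\<in>?C. g S * M S)"
    unfolding M_def sum_distrib_left by (rule sum.swap)
  finally have "(real (card ?B) * (\<theta> * ?N))\<^sup>2 \<le> (\<Sum>S\<in>?C. g S * M S)\<^sup>2"
    using assms by (intro power_mono) auto
  also have "\<dots> \<le> (\<Sum>S\<in>?C. (g S)\<^sup>2) * (\<Sum>S\<in>?C. (M S)\<^sup>2)" by (rule Cauchy_Schwarz_ineq_sum)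
  also have "\<dots> \<le> ?N * (\<Sum>S\<in>?C. (M S)\<^sup>2)"
  proof (intro mult_right_mono sum_nonneg)
    have "(\<Sum>S\<in>?C. (g S)\<^sup>2) \<le> (\<Sum>S\<in>?C. 1)" using g by (intro sum_mono) (simp add: abs_square_le_1)
    then show "(\<Sum>S\<in>?C. (g S)\<^sup>2) \<le> ?N" using N by simp
  qed auto
  also have "\<dots> \<le> ?N * (real (card ?B) * (?N * (real (card ?B) * (4 * t / real m) + ?N * ?e)))"
    by (intro mult_left_mono M2) auto
  finally have "(real (card ?B) * ?N\<^sup>2) * (real (card ?B) * \<theta>\<^sup>2) \<le>
      (real (card ?B) * ?N\<^sup>2) * (real (card ?B) * (4 * t / real m) + ?N * ?e)"
    by (simp only: power2_eq_square mult_ac)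
  then have "real (card ?B) * \<theta>\<^sup>2 \<le> real (card ?B) * (4 * t / real m) + ?N * ?e"
    by (rule mult_left_le_imp_le[OF _ mult_pos_pos]) (use False in \<open>simp_all only: of_nat_0_less_iff zero_less_power neq0_conv zero_less_numeral\<close>)
  then show ?thesis by (simp only: right_diff_distrib)
next
  case True
  show ?thesis unfolding True by simp
qed

section \<open>The hard family of distributions\<close>

lemma borel_measurable_dot: "dot d w \<in> borel_measurable (euclid d)"
  unfolding dot_def by measurable

text \<open>Coordinates below \<open>m\<close> carry the cube and coordinate \<open>m\<close> the
  extra basis vector, hence \<open>m < d\<close>. The cube has weight \<open>p\<close>, and odd
  \<open>m\<close> excludes ties.\<close>

locale hard_family =
  fixes m d :: nat and p :: real
  assumes odd_m: "odd m" and m_less_d: "m < d" and p_nonneg: "0 \<le> p" and p_le_1: "p \<le> 1"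
begin

lemma m_pos: "m > 0" using odd_m by (cases m) auto

fun example_point :: "nat set option \<Rightarrow> point" where
  "example_point None = (\<lambda>i\<in>{..<d}. if i = m then 1 else 0)"
| "example_point (Some S) = (\<lambda>i\<in>{..<d}. if i < m then of_int (sign_vec S i) / sqrt m else 0)"

declare example_point.simps [simp del]

text \<open>The squares of 3/5 and 4/5 add up to 1. The positive weight on coordinate
  \<open>m\<close> gives the extra point label 1 for every \<open>V\<close>.\<close>

definition normal :: "nat set \<Rightarrow> point" where
  "normal V = (\<lambda>i\<in>{..<d}. if i < m then 3/5 * (of_int (sign_vec V i) / sqrt m)
                         else if i = m then 4/5 else 0)"

section \<open>Geometry of the points and normals\<close>

lemma sum_split_coord:
  fixes f :: "nat \<Rightarrow> real"
  assumes "\<And>i. m < i \<Longrightarrow> i < d \<Longrightarrow> f i = 0"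
  shows "(\<Sum>i<d. f i) = (\<Sum>i<m. f i) + f m"
proof -
  have "(\<Sum>i<d. f i) = (\<Sum>i<Suc m. f i)"
    using m_less_d assms by (intro sum.mono_neutral_right) auto
  then show ?thesis by simp
qed

lemma sign_vec_square: "real_of_int (sign_vec S i) * real_of_int (sign_vec S i) = 1"
  by (simp add: sign_vec_def)

lemma dot_normal_None: "dot d (normal V) (example_point None) = 4/5"
  using m_less_d unfolding dot_def by (subst sum_split_coord) (auto simp: normal_def example_point.simps)

lemma dot_normal_Some: "dot d (normal V) (example_point (Some S)) = 3/5 * of_int (sign_inner m V S) / real m"
proof -
  have "dot d (normal V) (example_point (Some S)) = (\<Sum>i<m. 3/5 * of_int (sign_vec V i * sign_vec S i) / real m)"
    using m_less_d unfolding dot_def by (subst sum_split_coord) (auto simp: normal_def example_point.simps mult.assoc intro!: sum.cong)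
  then show ?thesis by (simp add: sign_inner_def sum_distrib_left sum_divide_distrib)
qed

lemma example_point_in_sphere: "example_point x \<in> unit_sphere d"
proof (cases x)
  case None
  have "(\<Sum>i<d. (example_point x i)\<^sup>2) = 1"
    using m_less_d None by (subst sum_split_coord) (auto simp: example_point.simps)
  moreover have "example_point x \<in> space (euclid d)" by (auto simp: None space_PiM example_point.simps)
  ultimately show ?thesis by (simp add: unit_sphere_def L2_set_def)
next
  case (Some S)
  have "(\<Sum>i<d. (example_point x i)\<^sup>2) = (\<Sum>i<m. 1 / real m)"
    using m_less_d Some
    by (subst sum_split_coord) (auto intro!: sum.cong simp: example_point.simps power2_eq_square sign_vec_square)
  also have "\<dots> = 1" using m_pos by simp
  moreover have "example_point x \<in> space (euclid d)" by (auto simp: Some space_PiM example_point.simps)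
  ultimately show ?thesis by (simp add: unit_sphere_def L2_set_def)
qed

lemma normal_in_sphere: "normal V \<in> unit_sphere d"
proof -
  have "(\<Sum>i<d. (normal V i)\<^sup>2) = (\<Sum>i<m. 9/25 / real m) + 16/25"
    using m_less_d
    by (subst sum_split_coord) (auto intro!: sum.cong simp: normal_def power2_eq_square sign_vec_square)
  also have "\<dots> = 1" using m_pos by simp
  moreover have "normal V \<in> space (euclid d)" by (auto simp: normal_def space_PiM)
  ultimately show ?thesis by (simp add: unit_sphere_def L2_set_def)
qed

text \<open>A sum of \<open>m\<close> odd terms. Hence no inner product vanishes:
  \<open>sign\<close> and \<open>sgn\<close> agree on the cube, and the margin there is that of an
  integer at least 1.\<close>

lemma odd_sign_inner: "odd (sign_inner m V S)"
proof -
  have "even (\<Sum>i<n. sign_vec V i * sign_vec S i) \<longleftrightarrow> even n" for n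
    by (induction n) (auto simp: sign_vec_def)
  then show ?thesis using odd_m by (simp add: sign_inner_def)
qed

definition true_label :: "nat set \<Rightarrow> nat set option \<Rightarrow> int" where
  "true_label V x = sign (dot d (normal V) (example_point x))"

lemma true_label_cases: "true_label V x = 1 \<or> true_label V x = - 1"
  by (simp add: true_label_def sign_def)

lemma true_label_None: "true_label V None = 1"
  unfolding true_label_def dot_normal_None by (simp add: sign_def)

lemma true_label_Some: "real_of_int (true_label V (Some S)) = majority m V S"
proof -
  have "sign_inner m V S \<noteq> 0" using odd_sign_inner[of V S] by auto
  then show ?thesis
    unfolding true_label_def dot_normal_Some using m_pos
    by (auto simp: sign_def majority_def sgn_if zero_le_divide_iff)
qed

lemma margin: "3 / (5 * real m) \<le> \<bar>dot d (normal V) (example_point x)\<bar>"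
proof (cases x)
  case None
  have "real m \<ge> 1" using m_pos by simp
  then have "3 / (5 * real m) \<le> 3 / 5" by (intro divide_left_mono) auto
  then show ?thesis unfolding None dot_normal_None by simp
next
  case (Some S)
  have "sign_inner m V S \<noteq> 0" using odd_sign_inner[of V S] by auto
  then have "\<bar>real_of_int (sign_inner m V S)\<bar> \<ge> 1" by linarith
  then show ?thesis unfolding Some dot_normal_Some using m_pos
    by (simp add: abs_mult divide_right_mono field_simps)
qed

text \<open>The Boolean says whether the label is flipped. The law does not involve
  \<open>V\<close>, which enters only through \<open>example\<close>.\<close>

definition seed :: "(nat set option \<times> bool) pmf" where
  "seed = pair_pmf
     (bernoulli_pmf p \<bind> (\<lambda>b. if b then map_pmf Some (pmf_of_set (Pow {..<m})) else return_pmf None))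
     (bernoulli_pmf (1/3))"

definition example :: "nat set \<Rightarrow> nat set option \<times> bool \<Rightarrow> point \<times> int" where
  "example V s = (example_point (fst s), if snd s then - true_label V (fst s) else true_label V (fst s))"

definition hard_dist :: "nat set \<Rightarrow> (point \<times> int) measure" where
  "hard_dist V = distr (measure_pmf seed) (example_space d) (example V)"

definition mixture_mean :: "(nat set option \<Rightarrow> real) \<Rightarrow> real" where
  "mixture_mean f = p * ((\<Sum>S\<in>Pow {..<m}. f (Some S)) / 2 ^ m) + (1 - p) * f None"

section \<open>Integrals against the hard distributions as finite sums\<close>

lemma space_sphere_space: "space (sphere_space d) = unit_sphere d"
  by (auto simp: sphere_space_def space_restrict_space unit_sphere_def)

lemma space_example_space: "space (example_space d) = unit_sphere d \<times> {-1, 1}"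
  by (simp add: example_space_def space_pair_measure space_sphere_space)

lemma example_point_in_space: "(example_point x, 1) \<in> space (example_space d)" "(example_point x, - 1) \<in> space (example_space d)"
  by (simp_all add: space_example_space example_point_in_sphere)

lemma example_in_space: "example V s \<in> space (example_space d)"
  using true_label_cases[of V "fst s"] by (auto simp: example_def space_example_space example_point_in_sphere)

lemma measurable_example: "example V \<in> measurable (measure_pmf seed) (example_space d)"
  using example_in_space by simp

lemma prob_space_hard_dist: "prob_space (hard_dist V)"
  unfolding hard_dist_def by (intro prob_space.prob_space_distr prob_space_measure_pmf measurable_example)

lemma sets_hard_dist: "sets (hard_dist V) = sets (example_space d)" and
  space_hard_dist: "space (hard_dist V) = space (example_space d)"
  by (simp_all add: hard_dist_def)

text \<open>The support is finite, so the expectation is a weighted sum. The noise is summed out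
  with weights 2/3 and 1/3, and only the choice of the point remains.\<close>

lemma integral_seed:
  "measure_pmf.expectation seed f = mixture_mean (\<lambda>x. 2/3 * f (x, False) + 1/3 * f (x, True))"
proof -
  let ?X = "bernoulli_pmf p \<bind> (\<lambda>b. if b then map_pmf Some (pmf_of_set (Pow {..<m})) else return_pmf None)"
  let ?A = "insert None (Some ` Pow {..<m})"
  have fin: "finite (?A \<times> (UNIV :: bool set))" by auto
  have set: "set_pmf seed \<subseteq> ?A \<times> UNIV"
    unfolding seed_def by (auto simp: set_pmf_of_set Pow_not_empty split: if_splits)
  have S: "pmf ?X (Some S) = p / 2 ^ m" if "S \<in> Pow {..<m}" for S
  proof -
    have "pmf (map_pmf Some (pmf_of_set (Pow {..<m}))) (Some S) = 1 / 2 ^ m"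
      using that by (subst pmf_map_inj') (auto simp: pmf_of_set Pow_not_empty card_Pow indicator_def)
    then show ?thesis using p_nonneg p_le_1 by (simp add: pmf_bind)
  qed
  have N: "pmf ?X None = 1 - p"
  proof -
    have "pmf (map_pmf Some (pmf_of_set (Pow {..<m}))) None = 0"
      by (auto simp: pmf_eq_0_set_pmf)
    then show ?thesis using p_nonneg p_le_1 by (simp add: pmf_bind)
  qed
  have "measure_pmf.expectation seed f = (\<Sum>a\<in>?A \<times> UNIV. f a * pmf seed a)"
    using set fin by (intro integral_measure_pmf_real) auto
  also have "\<dots> = (\<Sum>x\<in>?A. \<Sum>b\<in>UNIV. f (x, b) * (pmf ?X x * pmf (bernoulli_pmf (1/3)) b))"
    unfolding seed_def sum.cartesian_product by (intro sum.cong) (auto simp: pmf_pair)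
  also have "\<dots> = (\<Sum>x\<in>?A. pmf ?X x * (2/3 * f (x, False) + 1/3 * f (x, True)))"
    by (intro sum.cong refl) (simp add: UNIV_bool algebra_simps)
  also have "\<dots> = (1 - p) * (2/3 * f (None, False) + 1/3 * f (None, True)) +
      (\<Sum>x\<in>Some ` Pow {..<m}. pmf ?X x * (2/3 * f (x, False) + 1/3 * f (x, True)))"
    by (subst sum.insert) (auto simp: N)
  also have "(\<Sum>x\<in>Some ` Pow {..<m}. pmf ?X x * (2/3 * f (x, False) + 1/3 * f (x, True))) =
      (\<Sum>T\<in>Pow {..<m}. p / 2 ^ m * (2/3 * f (Some T, False) + 1/3 * f (Some T, True)))"
    by (subst sum.reindex) (auto intro!: sum.cong simp: S)
  also have "\<dots> = p * ((\<Sum>T\<in>Pow {..<m}. 2/3 * f (Some T, False) + 1/3 * f (Some T, True)) / 2 ^ m)"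
    unfolding sum_distrib_left[symmetric] by simp
  finally show ?thesis by (simp add: mixture_mean_def)
qed

lemma integral_hard_dist:
  assumes "f \<in> borel_measurable (example_space d)"
  shows "(\<integral>z. f z \<partial>hard_dist V) = mixture_mean (\<lambda>x. 2/3 * f (example_point x, true_label V x) + 1/3 * f (example_point x, - true_label V x))"
  unfolding hard_dist_def integral_distr[OF measurable_example assms] integral_seed
  by (simp add: example_def)

lemma measure_hard_dist:
  assumes "{z \<in> space (example_space d). P z} \<in> sets (example_space d)"
  shows "measure (hard_dist V) {z \<in> space (hard_dist V). P z} =
    mixture_mean (\<lambda>x. 2/3 * of_bool (P (example_point x, true_label V x)) + 1/3 * of_bool (P (example_point x, - true_label V x)))"
proof -
  let ?E = "{z \<in> space (example_space d). P z}"
  interpret prob_space "hard_dist V" by (rule prob_space_hard_dist)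
  have "measure (hard_dist V) {z \<in> space (hard_dist V). P z} = (\<integral>z. indicator ?E z \<partial>hard_dist V)"
    using assms by (simp add: space_hard_dist sets_hard_dist)
  also have "\<dots> = mixture_mean (\<lambda>x. 2/3 * indicator ?E (example_point x, true_label V x) + 1/3 * indicator ?E (example_point x, - true_label V x))"
    using assms by (intro integral_hard_dist) simp
  also have "\<dots> = mixture_mean (\<lambda>x. 2/3 * of_bool (P (example_point x, true_label V x)) + 1/3 * of_bool (P (example_point x, - true_label V x)))"
  proof -
    have "indicator ?E (example_point x, c) = (of_bool (P (example_point x, c)) :: real)" if "c = 1 \<or> c = -1" for x c
      using that example_point_in_space[of x] by (auto simp: indicator_def)
    moreover have "- true_label V x = 1 \<or> - true_label V x = -1" for x using true_label_cases[of V x] by auto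
    ultimately show ?thesis using true_label_cases by simp
  qed
  finally show ?thesis .
qed

section \<open>The hard distributions are noisy halfspaces\<close>

lemma measurable_fst_example: "fst \<in> measurable (example_space d) (sphere_space d)"
  unfolding example_space_def by (rule measurable_fst)

lemma pred_fst:
  assumes "S \<in> sets (sphere_space d)"
  shows "Measurable.pred (example_space d) (\<lambda>z. fst z \<in> S)"
  by (rule pred_sets2[OF assms measurable_fst_example])

lemma pred_snd: "Measurable.pred (example_space d) (\<lambda>z. snd z = c)"
  by (rule measurable_compose[of snd _ "count_space {-1, 1}"])
    (simp_all add: example_space_def)

lemma borel_measurable_dot_fst [measurable]:
  "(\<lambda>z. dot d w (fst z)) \<in> borel_measurable (example_space d)"
  by (rule measurable_compose[OF measurable_fst_example])
    (simp add: sphere_space_def measurable_restrict_space1 borel_measurable_dot)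

lemma pred_snd_eq_sign:
  assumes "S \<in> sets (sphere_space d)"
  shows "{z \<in> space (example_space d). fst z \<in> S \<and> snd z = sign (dot d w (fst z))} \<in> sets (example_space d)"
    and "{z \<in> space (example_space d). fst z \<in> S \<and> snd z = - sign (dot d w (fst z))} \<in> sets (example_space d)"
proof -
  \<comment> \<open>Splitting by the sign of the inner product leaves Boolean combinations of events
    with constant labels.\<close>
  have eq: "(snd z = sign (dot d w (fst z))) \<longleftrightarrow>
      (dot d w (fst z) \<ge> 0 \<and> snd z = 1 \<or> \<not> dot d w (fst z) \<ge> 0 \<and> snd z = -1)"
    "(snd z = - sign (dot d w (fst z))) \<longleftrightarrow>
      (dot d w (fst z) \<ge> 0 \<and> snd z = -1 \<or> \<not> dot d w (fst z) \<ge> 0 \<and> snd z = 1)"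
    for z :: "point \<times> int" by (auto simp: sign_def)
  have dot: "Measurable.pred (example_space d) (\<lambda>z. dot d w (fst z) \<ge> 0)" by measurable
  show "{z \<in> space (example_space d). fst z \<in> S \<and> snd z = sign (dot d w (fst z))} \<in> sets (example_space d)"
    "{z \<in> space (example_space d). fst z \<in> S \<and> snd z = - sign (dot d w (fst z))} \<in> sets (example_space d)"
    unfolding eq by (intro predE pred_intros_logic pred_fst[OF assms] pred_snd dot)+
qed

lemma rcn_halfspace_hard_dist:
  assumes "\<gamma> \<le> 3 / (5 * real m)"
  shows "rcn_halfspace d (1/3) \<gamma> (hard_dist V)"
  unfolding rcn_halfspace_def
proof (intro conjI bexI[OF _ normal_in_sphere] ballI)
  let ?E = "example_space d"
  show "measure (hard_dist V) {z \<in> space (hard_dist V). \<bar>dot d (normal V) (fst z)\<bar> < \<gamma>} = 0"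
  proof (subst measure_hard_dist)
    show "{z \<in> space ?E. \<bar>dot d (normal V) (fst z)\<bar> < \<gamma>} \<in> sets ?E" by measurable
    have "\<not> \<bar>dot d (normal V) (example_point x)\<bar> < \<gamma>" for x using margin[of V x] assms by linarith
    then show "mixture_mean (\<lambda>x. 2/3 * of_bool (\<bar>dot d (normal V) (fst (example_point x, true_label V x))\<bar> < \<gamma>) +
        1/3 * of_bool (\<bar>dot d (normal V) (fst (example_point x, - true_label V x))\<bar> < \<gamma>)) = 0"
      by (simp add: mixture_mean_def)
  qed
  fix S assume S: "S \<in> sets (sphere_space d)"
  have scale: "mixture_mean (\<lambda>x. c * f x) = c * mixture_mean f" for c f
    by (simp add: mixture_mean_def algebra_simps flip: sum_distrib_left)
  have total: "measure (hard_dist V) {z \<in> space (hard_dist V). fst z \<in> S} = mixture_mean (\<lambda>x. of_bool (example_point x \<in> S))"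
    by (subst measure_hard_dist) (simp_all add: predE[OF pred_fst[OF S]])
  have true_label_ne: "true_label V x \<noteq> - true_label V x" for x using true_label_cases[of V x] by auto
  show "measure (hard_dist V) {z \<in> space (hard_dist V). fst z \<in> S \<and> snd z = sign (dot d (normal V) (fst z))} =
      (1 - 1/3) * measure (hard_dist V) {z \<in> space (hard_dist V). fst z \<in> S}"
  proof (subst measure_hard_dist)
    show "{z \<in> space ?E. fst z \<in> S \<and> snd z = sign (dot d (normal V) (fst z))} \<in> sets ?E"
      by (rule pred_snd_eq_sign[OF S])
    \<comment> \<open>The two labels at a point differ, so only the summand with weight 2/3
      survives.\<close>
    have weight: "2/3 * of_bool (example_point x \<in> S \<and> true_label V x = true_label V x) + 1/3 * of_bool (example_point x \<in> S \<and> - true_label V x = true_label V x)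
       = 2/3 * (of_bool (example_point x \<in> S) :: real)" for x using true_label_ne[of x] by auto
    then show "mixture_mean (\<lambda>x. 2/3 * of_bool (fst (example_point x, true_label V x) \<in> S \<and>
         snd (example_point x, true_label V x) = sign (dot d (normal V) (fst (example_point x, true_label V x)))) +
       1/3 * of_bool (fst (example_point x, - true_label V x) \<in> S \<and>
         snd (example_point x, - true_label V x) = sign (dot d (normal V) (fst (example_point x, - true_label V x))))) =
       (1 - 1/3) * measure (hard_dist V) {z \<in> space (hard_dist V). fst z \<in> S}"
      unfolding total fst_conv snd_conv true_label_def[symmetric] weight scale by simp
  qed
  show "measure (hard_dist V) {z \<in> space (hard_dist V). fst z \<in> S \<and> snd z = - sign (dot d (normal V) (fst z))} =
      1/3 * measure (hard_dist V) {z \<in> space (hard_dist V). fst z \<in> S}"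
  proof (subst measure_hard_dist)
    show "{z \<in> space ?E. fst z \<in> S \<and> snd z = - sign (dot d (normal V) (fst z))} \<in> sets ?E"
      by (rule pred_snd_eq_sign[OF S])
    have weight: "2/3 * of_bool (example_point x \<in> S \<and> true_label V x = - true_label V x) + 1/3 * of_bool (example_point x \<in> S \<and> - true_label V x = - true_label V x)
       = 1/3 * (of_bool (example_point x \<in> S) :: real)" for x using true_label_ne[of x] by auto
    then show "mixture_mean (\<lambda>x. 2/3 * of_bool (fst (example_point x, true_label V x) \<in> S \<and>
         snd (example_point x, true_label V x) = - sign (dot d (normal V) (fst (example_point x, true_label V x)))) +
       1/3 * of_bool (fst (example_point x, - true_label V x) \<in> S \<and>
         snd (example_point x, - true_label V x) = - sign (dot d (normal V) (fst (example_point x, - true_label V x))))) =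
       1/3 * measure (hard_dist V) {z \<in> space (hard_dist V). fst z \<in> S}"
      unfolding total fst_conv snd_conv true_label_def[symmetric] weight scale by simp
  qed
qed (auto simp: prob_space_hard_dist sets_hard_dist)

text \<open>The expectation if the labels on the cube were fair coins.\<close>

definition null_mean :: "(point \<times> int \<Rightarrow> real) \<Rightarrow> real" where
  "null_mean f = p * ((\<Sum>S\<in>Pow {..<m}. (f (example_point (Some S), 1) + f (example_point (Some S), -1)) / 2) / 2 ^ m) +
     (1 - p) * (2/3 * f (example_point None, 1) + 1/3 * f (example_point None, -1))"

text \<open>At the extra point the label law is the same for all \<open>V\<close> and cancels. On
  the cube the noise leaves a bias of 1/3 towards the majority, so a query sees \<open>V\<close>
  only through the correlation of its label-odd part with the majority.\<close>

lemma integral_hard_dist_minus_null: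
  assumes "f \<in> borel_measurable (example_space d)"
  shows "(\<integral>z. f z \<partial>hard_dist V) - null_mean f =
    p / 3 * ((\<Sum>S\<in>Pow {..<m}. (f (example_point (Some S), 1) - f (example_point (Some S), -1)) / 2 * majority m V S) / 2 ^ m)"
proof -
  have e: "2/3 * f (example_point (Some S), true_label V (Some S)) + 1/3 * f (example_point (Some S), - true_label V (Some S)) =
      (f (example_point (Some S), 1) + f (example_point (Some S), -1)) / 2 +
      1/3 * ((f (example_point (Some S), 1) - f (example_point (Some S), -1)) / 2 * majority m V S)" for S
    using true_label_cases[of V "Some S"] by (auto simp: field_simps simp flip: true_label_Some)
  have lin: "p * ((X + 1/3 * Y) / N) + Z - (p * (X / N) + Z) = p / 3 * (Y / N)" for X Y Z N :: real
    by (simp add: add_divide_distrib distrib_left)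
  show ?thesis
    unfolding integral_hard_dist[OF assms] null_mean_def mixture_mean_def true_label_None e sum.distrib
      sum_distrib_left[symmetric] by (rule lin)
qed

text \<open>At a point the error probability is 1/2 minus 1/6 of the product of \<open>h\<close> and
  the true label. It is at least 1/3 at the extra point, so nothing there offsets a lack of
  correlation on the cube.\<close>

lemma misclass_error_hard_dist:
  assumes h: "h \<in> measurable (euclid d) (count_space {-1, 1})"
    and err: "misclass_error (hard_dist V) h \<le> 1/3 + \<epsilon>"
  shows "p * (1 - (\<Sum>S\<in>Pow {..<m}. of_int (h (example_point (Some S))) * majority m V S) / 2 ^ m) \<le> 6 * \<epsilon>"
proof -
  have h1: "h (example_point x) = 1 \<or> h (example_point x) = -1" for x
    using measurable_space[OF h, of "example_point x"] example_point_in_sphere[of x] by (auto simp: unit_sphere_def)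
  have hp: "Measurable.pred (example_space d) (\<lambda>z. h (fst z) = c)" for c
  proof -
    have "h \<in> measurable (sphere_space d) (count_space {-1, 1})"
      unfolding sphere_space_def by (intro measurable_restrict_space1 h)
    with measurable_fst_example have "(\<lambda>z. h (fst z)) \<in> measurable (example_space d) (count_space {-1, 1})"
      by (rule measurable_compose)
    then show ?thesis by (rule measurable_compose) simp
  qed
  have hs: "{z \<in> space (example_space d). h (fst z) \<noteq> snd z} \<in> sets (example_space d)"
  proof -
    have "h x = 1 \<or> h x = -1" if "x \<in> unit_sphere d" for x
      using measurable_space[OF h, of x] that by (auto simp: unit_sphere_def)
    then have "{z \<in> space (example_space d). h (fst z) \<noteq> snd z} =
        {z \<in> space (example_space d). h (fst z) = 1 \<and> snd z = -1 \<or> h (fst z) = -1 \<and> snd z = 1}"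
      by (fastforce simp: space_example_space)
    also have "\<dots> \<in> sets (example_space d)"
      by (intro predE pred_intros_logic hp pred_snd)
    finally show ?thesis .
  qed
  have e: "2/3 * of_bool (h (example_point x) \<noteq> true_label V x) + 1/3 * of_bool (h (example_point x) \<noteq> - true_label V x) =
      1/2 - 1/6 * (of_int (h (example_point x)) * real_of_int (true_label V x))" for x
    using h1[of x] true_label_cases[of V x] by auto
  let ?c = "(\<Sum>S\<in>Pow {..<m}. of_int (h (example_point (Some S))) * majority m V S) / 2 ^ m"
  have "misclass_error (hard_dist V) h = mixture_mean (\<lambda>x. 1/2 - 1/6 * (of_int (h (example_point x)) * real_of_int (true_label V x)))"
    unfolding misclass_error_def by (subst measure_hard_dist[OF hs]) (simp only: fst_conv snd_conv e)
  also have "\<dots> = p * (1/2 - 1/6 * ?c) + (1 - p) * (1/2 - 1/6 * of_int (h (example_point None)))"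
    by (simp only: mixture_mean_def true_label_None true_label_Some sum_subtractf sum_distrib_left[symmetric]
        diff_divide_distrib) (simp add: card_Pow)
  finally have "p * (1/2 - 1/6 * ?c) + (1 - p) * (1/2 - 1/6 * of_int (h (example_point None))) \<le> 1/3 + \<epsilon>"
    using err by simp
  moreover have "(1 - p) * (1/3) \<le> (1 - p) * (1/2 - 1/6 * of_int (h (example_point None)))"
    using p_le_1 h1[of None] by (intro mult_left_mono) auto
  ultimately have "p * (1/2 - 1/6 * ?c) + (1 - p) * (1/3) \<le> 1/3 + \<epsilon>" by linarith
  moreover have lin: "p * (1/2 - 1/6 * c) + (1 - p) * (1/3) = p * (1 - c) / 6 + 1/3" for c
    by (simp add: field_simps)
  moreover have "y \<le> 6 * \<epsilon>" if "y / 6 + 1/3 \<le> 1/3 + \<epsilon>" for y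
    using that by linarith
  ultimately show ?thesis unfolding lin by blast
qed

end

section \<open>Runs against the uninformative oracle\<close>

lemma run_from_queries_extend: "\<exists>ys. fst (run_from orc hist A) = hist @ ys"
proof (induction A arbitrary: hist)
  case (Query q k)
  then obtain ys where "fst (run_from orc (hist @ [q]) (k (orc hist q))) = (hist @ [q]) @ ys"
    by blast
  then show ?case by auto
qed simp

text \<open>With answers that ignore the history, both runs follow the same branch up to the first
  query answered differently. That query stands at the same position in both transcripts.\<close>

lemma run_from_diverge:
  "run_from (\<lambda>_. e) hist A = run_from (\<lambda>_. e') hist A \<or>
   (\<exists>xs q ys zs. fst (run_from (\<lambda>_. e) hist A) = hist @ xs @ q # ys \<and>
      fst (run_from (\<lambda>_. e') hist A) = hist @ xs @ q # zs \<and> e q \<noteq> e' q)"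
proof (induction A arbitrary: hist)
  case (Query q k)
  show ?case
  proof (cases "e q = e' q")
    case True
    have "k (e q) \<in> range k" by simp
    from Query.IH[OF this, of "hist @ [q]"] show ?thesis
    proof (elim disjE exE conjE)
      fix xs r ys zs
      assume "fst (run_from (\<lambda>_. e) (hist @ [q]) (k (e q))) = (hist @ [q]) @ xs @ r # ys"
        "fst (run_from (\<lambda>_. e') (hist @ [q]) (k (e q))) = (hist @ [q]) @ xs @ r # zs" "e r \<noteq> e' r"
      with True show ?thesis
        by (intro disjI2 exI[of _ "q # xs"] exI[of _ r] exI[of _ ys] exI[of _ zs]) simp
    qed (use True in simp)
  next
    case False
    obtain ys zs where "fst (run_from (\<lambda>_. e) (hist @ [q]) (k (e q))) = (hist @ [q]) @ ys"
      "fst (run_from (\<lambda>_. e') (hist @ [q]) (k (e' q))) = (hist @ [q]) @ zs"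
      using run_from_queries_extend by meson
    then show ?thesis using False
      by (intro disjI2 exI[of _ "[]"] exI[of _ q] exI[of _ ys] exI[of _ zs]) simp
  qed
qed simp

lemma well_formed_run_from:
  assumes "well_formed Z H A" "\<forall>q\<in>set hist. stat_query Z q"
  shows "(\<forall>q\<in>set (fst (run_from orc hist A)). stat_query Z q) \<and> snd (run_from orc hist A) \<in> H"
  using assms
proof (induction A arbitrary: hist)
  case (Query q k)
  then have "\<forall>r\<in>set (hist @ [q]). stat_query Z r" "well_formed Z H (k (orc hist q))" by auto
  from Query.IH[OF rangeI this(2,1)] show ?case by simp
qed simp

text \<open>Averaging: the expected number of events that occur is at least
  \<open>c * card I\<close>. This fixes one deterministic algorithm that succeeds for many
  directions at once.\<close>

lemma (in prob_space) exists_in_many_events: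
  assumes "finite I" "\<And>i. i \<in> I \<Longrightarrow> E i \<in> events" "\<And>i. i \<in> I \<Longrightarrow> c \<le> prob (E i)" "b < c" "I \<noteq> {}"
  shows "\<exists>x\<in>space M. b * real (card I) < real (card {i\<in>I. x \<in> E i})"
proof (rule ccontr)
  assume neg: "\<not> ?thesis"
  have "c * real (card I) \<le> (\<Sum>i\<in>I. prob (E i))"
    using sum_mono[of I "\<lambda>_. c" "\<lambda>i. prob (E i)"] assms(3) by (simp add: mult.commute)
  also have "\<dots> = (\<Sum>i\<in>I. expectation (indicator (E i)))"
    using assms(2) by (intro sum.cong) auto
  also have "\<dots> = expectation (\<lambda>x. \<Sum>i\<in>I. indicator (E i) x)"
    using assms(2) by (intro Bochner_Integration.integral_sum[symmetric] integrable_real_indicator) (auto simp: emeasure_eq_measure)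
  also have "\<dots> \<le> expectation (\<lambda>x. b * real (card I))"
  proof (intro integral_mono)
    show "integrable M (\<lambda>x. \<Sum>i\<in>I. indicator (E i) x :: real)"
      using assms(2) by (intro Bochner_Integration.integrable_sum integrable_real_indicator) (auto simp: emeasure_eq_measure)
    fix x assume "x \<in> space M"
    have "(\<Sum>i\<in>I. indicator (E i) x :: real) = real (card {i\<in>I. x \<in> E i})"
      using assms(1) by (simp add: indicator_def sum.If_cases Int_def)
    also have "\<dots> \<le> b * real (card I)" using neg \<open>x \<in> space M\<close> by force
    finally show "(\<Sum>i\<in>I. indicator (E i) x :: real) \<le> b * real (card I)" .
  qed simp
  also have "\<dots> = b * real (card I)" by (simp add: prob_space)
  finally show False using assms by (simp add: card_gt_0_iff)
qed

context hard_family
begin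

text \<open>The null mean is given up only where validity forces it, so the run for \<open>V\<close>
  leaves the run on null means only at a query that detects \<open>V\<close>.\<close>

definition answer :: "nat set \<Rightarrow> (point \<times> int) query \<Rightarrow> real" where
  "answer V q = (if \<bar>null_mean (fst q) - (\<integral>z. fst q z \<partial>hard_dist V)\<bar> \<le> snd q then null_mean (fst q)
                 else (\<integral>z. fst q z \<partial>hard_dist V))"

lemma stat_oracle_answer: "stat_oracle (hard_dist V) (\<lambda>_. answer V)"
  by (auto simp: stat_oracle_def answer_def stat_query_def)

text \<open>One deterministic \<open>A\<close> succeeds for more than 8/10 of the directions. For
  each of these, either the run on null means is followed to the end, and its output
  \<open>h\<close>, common to all \<open>V\<close>, has correlation at least 1/2 with the majority
  of \<open>V\<close>; or an early query detects \<open>V\<close>. By \<open>weak\<close> and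
  \<open>bad\<close> this covers at most 1/4 + 1/2 of the directions.\<close>

lemma sq_lower_bound:
  assumes learns: "sq_learns d (1/3) \<gamma> \<epsilon> M" and margin: "\<gamma> \<le> 3 / (5 * real m)"
    and p: "p = 12 * \<epsilon>" "0 < \<epsilon>" and Q: "Q \<ge> 0"
    and short: "\<not> some_run d (1/3) \<gamma> M (\<lambda>qs. real (length qs) \<ge> Q)"
    and tolerant: "\<not> some_run d (1/3) \<gamma> M (\<lambda>qs. \<exists>q\<in>set qs. snd q \<le> T)"
    and bad: "\<And>g. (\<And>S. \<bar>g S\<bar> \<le> 1) \<Longrightarrow>
      Q * real (card {V\<in>Pow {..<m}. \<bar>(\<Sum>S\<in>Pow {..<m}. g S * majority m V S) / 2 ^ m\<bar> > T / (4 * \<epsilon>)}) \<le> 1/2 * 2 ^ m"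
    and weak: "\<And>g. (\<And>S. \<bar>g S\<bar> \<le> 1) \<Longrightarrow>
      real (card {V\<in>Pow {..<m}. (\<Sum>S\<in>Pow {..<m}. g S * majority m V S) / 2 ^ m \<ge> 1/2}) \<le> 1/4 * 2 ^ m"
  shows False
proof -
  let ?N = "2 ^ m :: real" and ?C = "Pow {..<m}"
  let ?H = "measurable (euclid d) (count_space {-1, 1 :: int})"
  let ?run = "\<lambda>V A. run_from (\<lambda>_. answer V) [] A"
  have alg: "prob_space M" and wf: "\<And>A. A \<in> space M \<Longrightarrow> well_formed (example_space d) ?H A"
    using learns by (auto simp: sq_learns_def sq_algorithm_def)
  interpret prob_space M by (rule alg)
  have rcn: "rcn_halfspace d (1/3) \<gamma> (hard_dist V)" for V by (rule rcn_halfspace_hard_dist[OF margin])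
  define good where "good V A \<longleftrightarrow> misclass_error (hard_dist V) (snd (?run V A)) \<le> 1/3 + \<epsilon> \<and>
     real (length (fst (?run V A))) < Q \<and> (\<forall>q\<in>set (fst (?run V A)). T < snd q)" for V A
  have "\<exists>E\<in>events. prob E \<ge> 9/10 \<and> E \<subseteq> {A. good V A}" for V
  proof -
    obtain E where E: "E \<in> events" "E \<subseteq> {A. misclass_error (hard_dist V) (snd (?run V A)) \<le> 1/3 + \<epsilon>}"
      "prob E \<ge> 9/10"
      using learns rcn[of V] stat_oracle_answer[of V] unfolding sq_learns_def final_hyp_def by blast
    \<comment> \<open>Both bounds on the run hold almost surely; their exceptional null set is
      removed from the success event without changing its probability.\<close>
    have 1: "AE A in M. \<not> real (length (fst (?run V A))) \<ge> Q"
      using short rcn[of V] stat_oracle_answer[of V] unfolding some_run_def queries_def by blast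
    have 2: "AE A in M. \<not> (\<exists>q\<in>set (fst (?run V A)). snd q \<le> T)"
      using tolerant rcn[of V] stat_oracle_answer[of V] unfolding some_run_def queries_def by blast
    have "AE A in M. real (length (fst (?run V A))) < Q \<and> (\<forall>q\<in>set (fst (?run V A)). T < snd q)"
      using 1 2 by eventually_elim (auto simp: not_le)
    then obtain N where N: "N \<in> null_sets M"
      "{A \<in> space M. \<not> (real (length (fst (?run V A))) < Q \<and> (\<forall>q\<in>set (fst (?run V A)). T < snd q))} \<subseteq> N"
      by (auto simp: eventually_ae_filter)
    have "prob (E - N) = prob E" using E(1) N(1) by (rule measure_Diff_null_set)
    moreover have "E - N \<subseteq> {A. good V A}"
      using E(2) N(2) sets.sets_into_space[OF E(1)] by (auto simp: good_def)
    ultimately show ?thesis using E N(1) by (intro bexI[of _ "E - N"]) auto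
  qed
  then obtain E where E: "\<And>V. E V \<in> events" "\<And>V. prob (E V) \<ge> 9/10" "\<And>V. E V \<subseteq> {A. good V A}"
    by metis
  have "\<exists>A\<in>space M. 8/10 * real (card ?C) < real (card {V\<in>?C. A \<in> E V})"
    by (rule exists_in_many_events[where c = "9/10"]) (use E in auto)
  then obtain A where A: "A \<in> space M" "8/10 * ?N < real (card {V\<in>?C. A \<in> E V})"
    by (auto simp: card_Pow)
  define W where "W = {V\<in>?C. A \<in> E V}"
  define qs h where "qs = fst (run_from (\<lambda>_ q. null_mean (fst q)) [] A)"
    and "h = snd (run_from (\<lambda>_ q. null_mean (fst q)) [] A)"
  have qs: "\<And>q. q \<in> set qs \<Longrightarrow> stat_query (example_space d) q" and h: "h \<in> ?H"
    using well_formed_run_from[OF wf[OF A(1)], of "[]"] by (auto simp: qs_def h_def)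
  define weakly where "weakly = {V\<in>?C. (\<Sum>S\<in>?C. of_int (h (example_point (Some S))) * majority m V S) / ?N \<ge> 1/2}"
  define gq where "gq q S = (fst q (example_point (Some S), 1) - fst q (example_point (Some S), -1)) / 2"
    for q :: "(point \<times> int) query" and S
  define badq where "badq q = {V\<in>?C. \<bar>(\<Sum>S\<in>?C. gq q S * majority m V S) / ?N\<bar> > T / (4 * \<epsilon>)}" for q
  \<comment> \<open>The null means need not form a valid oracle, so \<open>qs\<close> may be long.
    Divergence happens within the run for \<open>V\<close>, whose length is below \<open>Q\<close>
    and counts the diverging query itself, hence \<open>Suc i\<close>.\<close>
  define I where "I = {i. i < length qs \<and> real (Suc i) < Q}"
  have "W \<subseteq> weakly \<union> (\<Union>i\<in>I. badq (qs ! i))"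
  proof
    fix V assume "V \<in> W"
    then have V: "V \<in> ?C" "good V A" using E(3) by (auto simp: W_def)
    from run_from_diverge[of "\<lambda>q. null_mean (fst q)" "[]" A "answer V"]
    show "V \<in> weakly \<union> (\<Union>i\<in>I. badq (qs ! i))"
    proof (elim disjE exE conjE)
      assume "run_from (\<lambda>_ q. null_mean (fst q)) [] A = ?run V A"
      then have "misclass_error (hard_dist V) h \<le> 1/3 + \<epsilon>" using V(2) by (simp add: good_def h_def)
      note misclass_error_hard_dist[OF h this]
      \<comment> \<open>As \<open>p = 12 * \<epsilon>\<close>, the bound
        \<open>6 * \<epsilon>\<close> is \<open>p / 2\<close>.\<close>
      moreover have "1/2 \<le> c" if "p * (1 - c) \<le> 6 * \<epsilon>" for c
      proof -
        have "p * (1 - c) \<le> p * (1/2)" using that p by simp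
        then have "1 - c \<le> 1/2" by (rule mult_left_le_imp_le) (use p in simp)
        then show ?thesis by simp
      qed
      ultimately have "V \<in> weakly" using V(1) unfolding weakly_def by blast
      then show ?thesis by simp
    next
      fix xs q ys zs
      assume *: "fst (run_from (\<lambda>_ q. null_mean (fst q)) [] A) = [] @ xs @ q # ys"
        "fst (?run V A) = [] @ xs @ q # zs" "null_mean (fst q) \<noteq> answer V q"
      have q: "qs ! length xs = q" "length xs < length qs" "q \<in> set qs"
        using *(1) by (auto simp: qs_def)
      have I: "length xs \<in> I" using V(2) *(2) q by (auto simp: I_def good_def)
      have T: "T < snd q" using V(2) *(2) by (auto simp: good_def)
      have "snd q < \<bar>(\<integral>z. fst q z \<partial>hard_dist V) - null_mean (fst q)\<bar>"
        using *(3) by (auto simp: answer_def split: if_splits)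
      \<comment> \<open>Here \<open>p / 3 = 4 * \<epsilon>\<close>, the source of the threshold
        \<open>T / (4 * \<epsilon>)\<close>.\<close>
      also have "\<dots> = 4 * \<epsilon> * \<bar>(\<Sum>S\<in>?C. gq q S * majority m V S) / ?N\<bar>"
        using qs[OF q(3)] p
        by (subst integral_hard_dist_minus_null) (auto simp: stat_query_def gq_def abs_mult)
      finally have "T < 4 * \<epsilon> * \<bar>(\<Sum>S\<in>?C. gq q S * majority m V S) / ?N\<bar>"
        using T by linarith
      then have "T / (4 * \<epsilon>) < \<bar>(\<Sum>S\<in>?C. gq q S * majority m V S) / ?N\<bar>"
        using p(2) by (subst pos_divide_less_eq) (auto simp only: mult_pos_pos zero_less_numeral mult.commute)
      then have "V \<in> badq (qs ! length xs)" using V(1) q by (simp add: badq_def)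
      then show ?thesis using I by blast
    qed
  qed
  then have "card W \<le> card (weakly \<union> (\<Union>i\<in>I. badq (qs ! i)))"
    by (intro card_mono) (auto simp: weakly_def badq_def I_def)
  also have "\<dots> \<le> card weakly + (\<Sum>i\<in>I. card (badq (qs ! i)))"
  proof -
    have "finite I" by (auto simp: I_def)
    then have "card (\<Union>i\<in>I. badq (qs ! i)) \<le> (\<Sum>i\<in>I. card (badq (qs ! i)))" by (rule card_UN_le)
    then show ?thesis
      using card_Un_le[of weakly "\<Union>i\<in>I. badq (qs ! i)"] by linarith
  qed
  finally have "real (card W) \<le> real (card weakly) + (\<Sum>i\<in>I. real (card (badq (qs ! i))))"
    by (simp flip: of_nat_sum of_nat_add)
  moreover have "real (card weakly) \<le> 1/4 * ?N"
  proof -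
    have "h (example_point x) = 1 \<or> h (example_point x) = -1" for x
      using measurable_space[OF h, of "example_point x"] example_point_in_sphere[of x] by (auto simp: unit_sphere_def)
    then have "\<bar>real_of_int (h (example_point x))\<bar> \<le> 1" for x
      by (metis abs_1 abs_minus_cancel of_int_1 of_int_minus order_refl)
    then show ?thesis unfolding weakly_def by (intro weak)
  qed
  moreover have "(\<Sum>i\<in>I. real (card (badq (qs ! i)))) \<le> 1/2 * ?N"
  proof (cases "I = {}")
    case False
    then have Q0: "Q > 0" by (auto simp: I_def)
    have "Q * real (card (badq q)) \<le> 1/2 * ?N" if "q \<in> set qs" for q
      unfolding badq_def
    proof (intro bad)
      fix S
      have "fst q (example_point (Some S), 1) \<in> {-1..1}" "fst q (example_point (Some S), -1) \<in> {-1..1}"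
        using qs[OF that] example_point_in_space[of "Some S"] by (auto simp: stat_query_def)
      then show "\<bar>gq q S\<bar> \<le> 1" by (auto simp: gq_def)
    qed
    then have "real (card (badq (qs ! i))) \<le> 1/2 * ?N / Q" if "i \<in> I" for i
      using that Q0 by (auto simp: I_def field_simps)
    then have "(\<Sum>i\<in>I. real (card (badq (qs ! i)))) \<le> real (card I) * (1/2 * ?N / Q)"
      by (rule sum_bounded_above)
    \<comment> \<open>Union bound: at most \<open>Q\<close> queries, each detecting at most a
      fraction \<open>1 / (2 * Q)\<close> of the directions.\<close>
    also have "\<dots> \<le> Q * (1/2 * ?N / Q)"
    proof -
      have "I \<subseteq> {..<nat \<lfloor>Q\<rfloor>}" by (auto simp: I_def le_nat_iff le_floor_iff) linarith
      then have "card I \<le> nat \<lfloor>Q\<rfloor>" using card_mono[of "{..<nat \<lfloor>Q\<rfloor>}" I] by simp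
      then have "real (card I) \<le> Q" using Q by linarith
      then show ?thesis using Q by (intro mult_right_mono) auto
    qed
    finally show ?thesis using Q0 by simp
  qed simp
  moreover have "8/10 * ?N < real (card W)" using A(2) by (simp add: W_def)
  moreover have "?N > 0" by simp
  ultimately show False by linarith
qed

end

section \<open>Choice of parameters\<close>

text \<open>The exponent \<open>\<gamma> powr (- 4 * c)\<close> outgrows both
  \<open>(1 / \<gamma>) powr c\<close> and the polynomial factor; this is what makes
  \<open>a = 1\<close> possible.\<close>

lemma eventually_card_correlated_small:
  fixes c :: real
  assumes "c > 0"
  shows "eventually (\<lambda>\<gamma>. 2 powr ((1 / \<gamma>) powr c) * (\<gamma> powr (2 * c - 1/2) * exp (- 8 * \<gamma> powr (- 4 * c))) \<le> 4)
     (at_right 0)"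
  using assms by real_asymp

text \<open>The one-sided bound is applied to \<open>g\<close> and to \<open>- g\<close>. Pairs are
  allowed correlation of order \<open>\<gamma> powr (1/2 - 2 * c)\<close>, for \<open>c > 0\<close>
  above the typical size, and Cauchy--Schwarz takes its root: hence \<open>1/4 - c\<close>.\<close>

lemma card_abs_correlated_majority:
  assumes m: "odd m" "1 / (4 * \<gamma>) \<le> real m" and \<gamma>: "\<gamma> > 0" and g: "\<And>S. \<bar>g S\<bar> \<le> 1"
  shows "real (card {V\<in>Pow {..<m}. \<bar>(\<Sum>S\<in>Pow {..<m}. g S * majority m V S) / 2 ^ m\<bar> > 8 * \<gamma> powr (1/4 - c)})
    \<le> 2 ^ m * (1/8 * (\<gamma> powr (2 * c - 1/2) * exp (- 8 * \<gamma> powr (- 4 * c))))"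
    (is "real (card ?B) \<le> 2 ^ m * (1/8 * (_ * ?e))")
proof -
  \<comment> \<open>The choice of \<open>t\<close> makes \<open>4 * t / m\<close> half of \<open>\<theta>\<^sup>2\<close>.\<close>
  define \<theta> t where "\<theta> = 8 * \<gamma> powr (1/4 - c)" and "t = real m * \<theta>\<^sup>2 / 8"
  have mpos: "m > 0" using m by (cases m) auto
  have \<theta>: "\<theta> > 0" using \<gamma> by (simp add: \<theta>_def)
  have "t \<ge> 0" by (simp add: t_def)
  have \<theta>2: "\<theta>\<^sup>2 = 64 * \<gamma> powr (1/2 - 2 * c)"
    by (simp add: \<theta>_def power_mult_distrib power2_eq_square flip: powr_add)
  have e: "exp (- t\<^sup>2 / (2 * real m)) \<le> ?e"
  proof -
    have "8 * \<gamma> powr (- 4 * c) = 32 * (1 / (4 * \<gamma>)) * \<gamma> powr (1 + - 4 * c)"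
      unfolding powr_add using \<gamma> by simp
    also have "\<dots> \<le> 32 * real m * \<gamma> powr (1 + - 4 * c)"
      using m(2) by (intro mult_right_mono mult_left_mono) auto
    also have "\<gamma> powr (1 + - 4 * c) = (\<gamma> powr (1/2 - 2 * c))\<^sup>2"
      by (simp add: power2_eq_square flip: powr_add)
    also have "32 * real m * \<dots> = t\<^sup>2 / (2 * real m)"
      using mpos unfolding t_def \<theta>2 by (simp add: power2_eq_square)
    finally show ?thesis by simp
  qed
  have one_sided: "real (card {V\<in>Pow {..<m}. (\<Sum>S\<in>Pow {..<m}. f S * majority m V S) > \<theta> * 2 ^ m}) * (\<theta>\<^sup>2 / 2)
      \<le> 2 ^ m * (2 * ?e)" if "\<And>S. \<bar>f S\<bar> \<le> 1" for f
  proof -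
    have "\<theta>\<^sup>2 - 4 * t / real m = \<theta>\<^sup>2 / 2" using mpos by (simp add: t_def)
    then have "real (card {V\<in>Pow {..<m}. (\<Sum>S\<in>Pow {..<m}. f S * majority m V S) > \<theta> * 2 ^ m}) * (\<theta>\<^sup>2 / 2)
        \<le> 2 ^ m * (2 * exp (- t\<^sup>2 / (2 * real m)))"
      using card_correlated_majority[OF m(1), of \<theta> t f] that \<theta> \<open>t \<ge> 0\<close> by simp
    also have "\<dots> \<le> 2 ^ m * (2 * ?e)" using e by (intro mult_left_mono) auto
    finally show ?thesis .
  qed
  let ?P = "\<lambda>f. {V\<in>Pow {..<m}. (\<Sum>S\<in>Pow {..<m}. f S * majority m V S) > \<theta> * 2 ^ m}"
  have "?B \<subseteq> ?P g \<union> ?P (\<lambda>S. - g S)"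
    unfolding \<theta>_def[symmetric] mult_minus_left sum_negf by (auto simp: abs_if field_simps split: if_splits)
  then have "card ?B \<le> card (?P g \<union> ?P (\<lambda>S. - g S))" by (intro card_mono) auto
  also have "\<dots> \<le> card (?P g) + card (?P (\<lambda>S. - g S))" by (rule card_Un_le)
  finally have "real (card ?B) * (\<theta>\<^sup>2 / 2) \<le> (real (card (?P g)) + real (card (?P (\<lambda>S. - g S)))) * (\<theta>\<^sup>2 / 2)"
    by (intro mult_right_mono) (simp_all flip: of_nat_add)
  also have "\<dots> \<le> 2 ^ m * (2 * ?e) + 2 ^ m * (2 * ?e)"
    unfolding distrib_right using g by (intro add_mono one_sided) auto
  finally have "real (card ?B) \<le> 2 ^ m * (8 / \<theta>\<^sup>2 * ?e)" using \<theta> by (simp add: field_simps)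
  also have "8 / \<theta>\<^sup>2 = 1/8 * \<gamma> powr (2 * c - 1/2)"
  proof -
    have "\<gamma> powr (2 * c - 1/2) = 1 / \<gamma> powr (1/2 - 2 * c)"
      using powr_minus_divide[of \<gamma> "1/2 - 2 * c"] by simp
    then show ?thesis by (simp add: \<theta>2)
  qed
  finally show ?thesis by simp
qed

lemma card_half_correlated_majority:
  assumes m: "odd m" and g: "\<And>S. \<bar>g S\<bar> \<le> 1"
  shows "real (card {V\<in>Pow {..<m}. (\<Sum>S\<in>Pow {..<m}. g S * majority m V S) / 2 ^ m \<ge> 1/2})
    \<le> 2 ^ m * (64 * exp (- real m / 32768))"
proof -
  \<comment> \<open>Lowering the threshold from 1/2 to 1/4 yields the strict inequality
    needed.\<close>
  let ?P = "{V\<in>Pow {..<m}. (\<Sum>S\<in>Pow {..<m}. g S * majority m V S) > 1/4 * 2 ^ m}"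
  have mpos: "m > 0" using m by (cases m) auto
  have pos: "(0::real) < 2 ^ m" by simp
  have "real (card {V\<in>Pow {..<m}. (\<Sum>S\<in>Pow {..<m}. g S * majority m V S) / 2 ^ m \<ge> 1/2}) \<le> real (card ?P)"
  proof (intro of_nat_mono card_mono subsetI)
    fix V assume V: "V \<in> {V\<in>Pow {..<m}. (\<Sum>S\<in>Pow {..<m}. g S * majority m V S) / 2 ^ m \<ge> 1/2}"
    then have "1/2 * 2 ^ m \<le> (\<Sum>S\<in>Pow {..<m}. g S * majority m V S)" by (simp add: field_simps)
    then have "1/4 * 2 ^ m < (\<Sum>S\<in>Pow {..<m}. g S * majority m V S)" using pos by linarith
    then show "V \<in> ?P" using V by simp
  qed auto
  \<comment> \<open>For \<open>\<theta> = 1/4\<close> and \<open>t = m / 128\<close>,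
    \<open>\<theta>\<^sup>2 - 4 * t / m\<close> is 1/32 and \<open>t\<^sup>2 / (2 * m)\<close> is
    \<open>m / 32768\<close>.\<close>
  moreover have "real (card ?P) * (1/32) \<le> 2 ^ m * (2 * exp (- real m / 32768))"
    using card_correlated_majority[OF m, of "1/4" "real m / 128" g] g mpos
    by (simp add: power2_eq_square)
  ultimately show ?thesis by simp
qed

theorem theorem1p4:
  "\<exists>a::real. a > 0 \<and> (\<forall>c::real. c > 0 \<longrightarrow>
     (\<exists>C::real. C > 0 \<and> (\<exists>\<gamma>\<^sub>0 \<epsilon>\<^sub>0 :: real. \<gamma>\<^sub>0 > 0 \<and> \<epsilon>\<^sub>0 > 0 \<and>
       (\<forall>(\<gamma>::real) (\<epsilon>::real) (d::nat) (M :: halfspace_tree measure).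
          0 < \<gamma> \<and> \<gamma> < \<gamma>\<^sub>0 \<and> 0 < \<epsilon> \<and> \<epsilon> < \<epsilon>\<^sub>0 \<and> real d \<ge> C / \<gamma> \<and>
          sq_learns d (1/3) \<gamma> \<epsilon> M \<longrightarrow>
            some_run d (1/3) \<gamma> M
              (\<lambda>qs. real (length qs) \<ge> 2 powr ((1 / \<gamma>) powr (a * c))) \<or>
            some_run d (1/3) \<gamma> M
              (\<lambda>qs. \<exists>q\<in>set qs. snd q \<le> C * \<epsilon> * \<gamma> powr (1/4 - c))))))"
proof (rule exI[of _ 1], intro conjI allI impI)
  fix c :: real assume c: "c > 0"
  \<comment> \<open>\<open>R \<gamma> / 8\<close> is the query bound times the fraction of
    directions that one query can detect.\<close>
  define R where "R \<gamma> = 2 powr ((1 / \<gamma>) powr c) * (\<gamma> powr (2 * c - 1/2) * exp (- 8 * \<gamma> powr (- 4 * c)))"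
    for \<gamma> :: real
  have "eventually (\<lambda>\<gamma>. R \<gamma> \<le> 4 \<and> 256 * exp (- (1 / (4 * \<gamma>)) / 32768) \<le> 1) (at_right 0)"
    unfolding R_def by (intro eventually_conj eventually_card_correlated_small[OF c]) real_asymp
  then obtain b where b: "b > 0" "\<And>\<gamma>. 0 < \<gamma> \<Longrightarrow> \<gamma> < b \<Longrightarrow> R \<gamma> \<le> 4"
    "\<And>\<gamma>. 0 < \<gamma> \<Longrightarrow> \<gamma> < b \<Longrightarrow> 256 * exp (- (1 / (4 * \<gamma>)) / 32768) \<le> 1"
    by (auto simp: eventually_at_right_field)
  show "\<exists>C::real. C > 0 \<and> (\<exists>\<gamma>\<^sub>0 \<epsilon>\<^sub>0 :: real. \<gamma>\<^sub>0 > 0 \<and> \<epsilon>\<^sub>0 > 0 \<and>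
       (\<forall>(\<gamma>::real) (\<epsilon>::real) (d::nat) (M :: halfspace_tree measure).
          0 < \<gamma> \<and> \<gamma> < \<gamma>\<^sub>0 \<and> 0 < \<epsilon> \<and> \<epsilon> < \<epsilon>\<^sub>0 \<and> real d \<ge> C / \<gamma> \<and>
          sq_learns d (1/3) \<gamma> \<epsilon> M \<longrightarrow>
            some_run d (1/3) \<gamma> M
              (\<lambda>qs. real (length qs) \<ge> 2 powr ((1 / \<gamma>) powr (1 * c))) \<or>
            some_run d (1/3) \<gamma> M
              (\<lambda>qs. \<exists>q\<in>set qs. snd q \<le> C * \<epsilon> * \<gamma> powr (1/4 - c))))"
  proof (rule exI[of _ 32], rule conjI, simp, rule exI[of _ "min b (1/10)"], rule exI[of _ "1/12"],
      intro conjI allI impI)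
    \<comment> \<open>\<open>C = 32\<close> makes \<open>?T / (4 * \<epsilon>)\<close> the threshold
      \<open>8 * \<gamma> powr (1/4 - c)\<close> and leaves room for \<open>m < d\<close>. The bound
      1/12 makes \<open>12 * \<epsilon>\<close> a probability, and 1/10 gives
      \<open>u \<ge> 5/2\<close>.\<close>
    fix \<gamma> \<epsilon> :: real and d :: nat and M :: "halfspace_tree measure"
    assume A: "0 < \<gamma> \<and> \<gamma> < min b (1/10) \<and> 0 < \<epsilon> \<and> \<epsilon> < 1/12 \<and> real d \<ge> 32 / \<gamma> \<and>
      sq_learns d (1/3) \<gamma> \<epsilon> M"
    then have \<gamma>: "0 < \<gamma>" "\<gamma> < b" "\<gamma> < 1/10" and \<epsilon>: "0 < \<epsilon>" "\<epsilon> < 1/12" by auto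
    define m where "m = 2 * nat \<lfloor>1 / (4 * \<gamma>)\<rfloor> + 1"
    define u where "u = 1 / (4 * \<gamma>)"
    have u: "u \<ge> 5/2" "1 / \<gamma> = 4 * u" using \<gamma> by (auto simp: u_def field_simps)
    \<comment> \<open>Since \<open>u \<ge> 5/2\<close>, the added 1 is at most
      \<open>2/5 * u\<close>. The upper bound \<open>12/5 * u\<close> is
      \<open>3 / (5 * \<gamma>)\<close>, exactly what the margin allows.\<close>
    have m: "odd m" "u \<le> real m" "real m \<le> 12/5 * u"
      using u(1) unfolding m_def u_def[symmetric] by (simp, linarith, linarith)
    have \<gamma>_le: "\<gamma> \<le> 3 / (5 * real m)"
    proof -
      have "real m > 0" using m(2) u(1) by linarith
      moreover have "5 * real m * \<gamma> \<le> 12 * u * \<gamma>"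
        using m(3) \<gamma> by (intro mult_right_mono) auto
      ultimately show ?thesis using \<gamma> by (simp add: u_def pos_le_divide_eq mult_ac)
    qed
    have md: "m < d"
    proof -
      have "real m < 32 * (1 / \<gamma>)" using m(3) u by linarith
      then show ?thesis using A by simp
    qed
    interpret hard_family m d "12 * \<epsilon>"
      using m md \<epsilon> by unfold_locales auto
    let ?Q = "2 powr ((1 / \<gamma>) powr (1 * c))" and ?T = "32 * \<epsilon> * \<gamma> powr (1/4 - c)"
    have T: "?T / (4 * \<epsilon>) = 8 * \<gamma> powr (1/4 - c)" using \<epsilon> by simp
    show "some_run d (1/3) \<gamma> M (\<lambda>qs. real (length qs) \<ge> ?Q) \<or>
        some_run d (1/3) \<gamma> M (\<lambda>qs. \<exists>q\<in>set qs. snd q \<le> ?T)"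
    proof (rule ccontr)
      assume neg: "\<not> ?thesis"
      show False
      proof (rule sq_lower_bound[of \<gamma> \<epsilon> M ?Q ?T])
        fix g :: "nat set \<Rightarrow> real" assume g: "\<And>S. \<bar>g S\<bar> \<le> 1"
        let ?B = "{V\<in>Pow {..<m}. \<bar>(\<Sum>S\<in>Pow {..<m}. g S * majority m V S) / 2 ^ m\<bar> > ?T / (4 * \<epsilon>)}"
        have "?Q * real (card ?B) \<le>
            ?Q * (2 ^ m * (1/8 * (\<gamma> powr (2 * c - 1/2) * exp (- 8 * \<gamma> powr (- 4 * c)))))"
          unfolding T using card_abs_correlated_majority[OF m(1) m(2)[unfolded u_def] \<gamma>(1) g]
          by (intro mult_left_mono) auto
        also have "\<dots> = 2 ^ m * (R \<gamma> / 8)" by (simp add: R_def)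
        also have "\<dots> \<le> 2 ^ m * (1/2)" using b(2)[OF \<gamma>(1,2)] by (intro mult_left_mono) auto
        finally show "?Q * real (card ?B) \<le> 1/2 * 2 ^ m" by simp
        have "256 * exp (- real m / 32768) \<le> 256 * exp (- (1 / (4 * \<gamma>)) / 32768)"
          using m(2) unfolding u_def[symmetric] by simp
        also have "\<dots> \<le> 1" using b(3)[OF \<gamma>(1,2)] .
        finally have "64 * exp (- real m / 32768) \<le> 1/4" by simp
        then have "2 ^ m * (64 * exp (- real m / 32768)) \<le> 2 ^ m * (1/4)"
          by (intro mult_left_mono) auto
        then show "real (card {V\<in>Pow {..<m}. (\<Sum>S\<in>Pow {..<m}. g S * majority m V S) / 2 ^ m \<ge> 1/2}) \<le> 1/4 * 2 ^ m"
          using card_half_correlated_majority[of m g, OF m(1) g]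
          by (simp only: mult.commute[of "1/4"])
      qed (use A neg \<gamma>_le in auto)
    qed
  qed (use b in auto)
qed simp

end
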